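(* Assume (A1) and (A2) hold (see context) and that the model is well specified: there is $\boldsymbol\beta^\star\in\mathbb R^p$ such that $f^\star(\boldsymbol x)=\boldsymbol x^\top\boldsymbol\beta^\star$ for $P_X$-almost every $\boldsymbol x$. Let $J^\star=\{j\in[p]:\beta^\star_j\ne0\}$ and $s^\star=|J^\star|$. Let $\delta\in(0,1)$ and let the tuning parameter $\lambda$ satisfy $$\lambda\ge4B_Y\Big(\frac{\log(4p/\delta)}{n}\Big)^{1/2}\bigg[1+\frac{B_X}{2}\Big(\frac{\log(4p/\delta)}{n}\Big)^{1/2}\bigg].$$ Let $\hat{\boldsymbol\beta}$ be the semi-supervised lasso estimator, $$\hat{\boldsymbol\beta}\in\operatorname*{arg\,min}_{\boldsymbol\beta\in\mathbb R^p}\Big\{\|\hat{\mathbf\Sigma}_{\rm all}^{1/2}\boldsymbol\beta\|_2^2-\frac2n\boldsymbol Y^\top\mathbf X_{\rm lab}\boldsymbol\beta+2\lambda\|\boldsymbol\beta\|_1\Big\}.$$ Then, with probability at least $1-\delta$, $$\mathcal E(f_{\hat{\boldsymbol\beta}})\le\min\bigg\{\bigg(\frac{6\lambda s^\star}{\bar\kappa_{\hat{\mathbf\Sigma}_{\rm all}}(J^\star,3)}\bigg)^2,\ \frac{9\|\mathbf\Sigma\|\lambda^2s^\star}{\kappa^{\rm RE}_{\hat{\mathbf\Sigma}_{\rm all}}(s^\star,3)^2}\bigg\}.$$ In addition, if the overall sample size $N$ is such that $$16\,s^\star B_X^2\sqrt{2\log(4p^2/\delta)}\le\bar\kappa_{\mathbf\Sigma}(J^\star,3)\sqrt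 N,$$ then, with probability at least $1-\delta$, $$\mathcal E(f_{\hat{\boldsymbol\beta}})\le\frac{9\lambda^2s^\star}{\bar\kappa_{\mathbf\Sigma}(J^\star,3)}.$$
   Context: Setting. $p\ge1$ and $1\le n<N$ are integers, $[k]=\{1,\dots,k\}$. $(\boldsymbol X,Y)$ is a random pair in $\mathbb R^p\times\mathbb R$ with distribution $P$; $P_X$ is the marginal distribution of $\boldsymbol X=(X^1,\dots,X^p)^\top$; $f^\star(\boldsymbol x)=\mathbb E[Y\mid\boldsymbol X=\boldsymbol x]$; $\mathbf\Sigma=\mathbb E[\boldsymbol X\boldsymbol X^\top]$. The labeled data $(\boldsymbol X_1,Y_1),\dots,(\boldsymbol X_n,Y_n)$ are i.i.d. with distribution $P$; the unlabeled data $\boldsymbol X_{n+1},\dots,\boldsymbol X_N$ are i.i.d. with distribution $P_X$ and independent of the labeled data. $\boldsymbol Y=(Y_1,\dots,Y_n)^\top$ and $\mathbf X_{\rm lab}\in\mathbb R^{n\times p}$ is the matrix with rows $\boldsymbol X_1^\top,\dots,\boldsymbol X_n^\top$. $\hat{\mathbf\Sigma}_{\rm all}=\frac1N\sum_{i=1}^N\boldsymbol X_i\boldsymbol X_i^\top$. $\|\mathbf A\|$ denotes the spectral norm of a matrix $\mathbf A$. Assumptions. (A1): $Y$ and $\boldsymbol X$ have zero mean and finite variance, and $\mathbb E[(X^j)^2]=1$ for all $j\in[p]$. (A2): there exist constants $B_Y,B_X$ such that $\mathbf P(|Y|\le B_Y;\ \max_{j\in[p]}|X^j|\le B_X)=1$.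 Linear predictors: $f_{\boldsymbol\beta}(\boldsymbol x)=\boldsymbol x^\top\boldsymbol\beta$. The excess risk is $\mathcal E(f)=\int(f(\boldsymbol x)-f^\star(\boldsymbol x))^2P_X(d\boldsymbol x)$; for a data-dependent $\hat{\boldsymbol\beta}$, $\mathcal E(f_{\hat{\boldsymbol\beta}})$ is the (random) value of $\boldsymbol\beta\mapsto\mathcal E(f_{\boldsymbol\beta})$ at $\hat{\boldsymbol\beta}$. The tuning parameter satisfies $\lambda>0$. For $J\subseteq[p]$ and $\boldsymbol v\in\mathbb R^p$, $\boldsymbol v_J\in\mathbb R^p$ has $j$-th coordinate $v_j$ if $j\in J$ and $0$ otherwise; $J^c=[p]\setminus J$. For a symmetric positive semidefinite $p\times p$ matrix $\mathbf A$ and $c>0$, $$\bar\kappa_{\mathbf A}(J,c)=\inf\bigg\{\frac{|J|\,\|\mathbf A^{1/2}\boldsymbol v\|_2^2}{\|\boldsymbol v_J\|_1^2}:\ \boldsymbol v\in\mathbb R^p,\ \|\boldsymbol v_{J^c}\|_1<c\|\boldsymbol v_J\|_1\bigg\},$$ $$\kappa^{\rm RE}_{\mathbf A}(J,c)=\inf\big\{\|\mathbf A^{1/2}\boldsymbol v\|_2^2:\ \|\boldsymbol v_{J^c}\|_1\le c\|\boldsymbol v_J\|_1\ \text{and}\ \|\boldsymbol v_J\|_2=1\big\},\qquad\kappa^{\rm RE}_{\mathbf A}(s,c)=\min_{J\subseteq[p]:|J|\le s}\kappa^{\rm RE}_{\mathbf A}(J,c).$$ Conventions: the infimum over the empty set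 is $+\infty$; a ratio with denominator $+\infty$ is $0$, and a positive number divided by $0$ is $+\infty$. *)

theory Defs
  imports "HOL-Probability.Probability"
begin

definition l1_norm :: "real ^ 'p \<Rightarrow> real" where
  "l1_norm v = (\<Sum>j\<in>UNIV. \<bar>v $ j\<bar>)"

definition restrict_vec :: "'p set \<Rightarrow> real ^ 'p \<Rightarrow> real ^ 'p" where
  "restrict_vec J v = (\<chi> j. if j \<in> J then v $ j else 0)"

definition outer :: "real ^ 'p \<Rightarrow> real ^ 'p ^ 'p" where
  "outer x = (\<chi> j k. x $ j * x $ k)"

definition psd :: "real ^ 'p ^ 'p \<Rightarrow> bool" where
  "psd A \<longleftrightarrow> transpose A = A \<and> (\<forall>v. 0 \<le> v \<bullet> (A *v v))"

(* Meaningful for positive semidefinite A only; such an A has exactly one root of this kind. *)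
definition psd_sqrt :: "real ^ 'p ^ 'p \<Rightarrow> real ^ 'p ^ 'p" where
  "psd_sqrt A = (THE B. psd B \<and> B ** B = A)"

definition spectral_norm :: "real ^ 'p ^ 'p \<Rightarrow> real" where
  "spectral_norm A = onorm (\<lambda>v. A *v v)"

(* Both constants are extended reals, so that the infimum over the empty set (J = {}) is \<infinity>.
   In ereal, r / \<infinity> = 0 for every real r, and r / 0 = \<infinity> for every real r > 0.
   In compatibility the real quotient never has a zero denominator: the constraint forces
   the l1-norm of the restriction of v to J to be positive. *)
definition compatibility :: "real ^ 'p ^ 'p \<Rightarrow> 'p set \<Rightarrow> real \<Rightarrow> ereal" where
  "compatibility A J c =
     (INF v \<in> {v. l1_norm (restrict_vec (- J) v) < c * l1_norm (restrict_vec J v)}.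
        ereal (real (card J) * (norm (psd_sqrt A *v v))\<^sup>2 / (l1_norm (restrict_vec J v))\<^sup>2))"

definition restricted_eigenvalue_on :: "real ^ 'p ^ 'p \<Rightarrow> 'p set \<Rightarrow> real \<Rightarrow> ereal" where
  "restricted_eigenvalue_on A J c =
     (INF v \<in> {v. l1_norm (restrict_vec (- J) v) \<le> c * l1_norm (restrict_vec J v)
                  \<and> norm (restrict_vec J v) = 1}.
        ereal ((norm (psd_sqrt A *v v))\<^sup>2))"

definition restricted_eigenvalue :: "real ^ 'p ^ 'p \<Rightarrow> nat \<Rightarrow> real \<Rightarrow> ereal" where
  "restricted_eigenvalue A s c =
     Min ((\<lambda>J. restricted_eigenvalue_on A J c) ` {J. card J \<le> s})"

definition marginal_X :: "((real ^ 'p) \<times> real) measure \<Rightarrow> (real ^ 'p) measure" where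
  "marginal_X P = distr P borel fst"

definition second_moment :: "((real ^ 'p) \<times> real) measure \<Rightarrow> real ^ 'p ^ 'p" where
  "second_moment P = (\<chi> j k. \<integral>x. outer x $ j $ k \<partial>marginal_X P)"

(* f is a version of x \<mapsto> E[Y | X = x] when (X, Y) has distribution P. *)
definition regression_function ::
    "((real ^ 'p) \<times> real) measure \<Rightarrow> (real ^ 'p \<Rightarrow> real) \<Rightarrow> bool" where
  "regression_function P f \<longleftrightarrow>
     f \<in> borel_measurable borel \<and>
     (AE z in P. real_cond_exp P (vimage_algebra (space P) fst borel) snd z = f (fst z))"

definition standardized :: "((real ^ 'p) \<times> real) measure \<Rightarrow> bool" where
  "standardized P \<longleftrightarrow>
     integrable P snd \<and> (\<integral>z. snd z \<partial>P) = 0 \<and> integrable P (\<lambda>z. (snd z)\<^sup>2) \<and>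
     (\<forall>j. integrable P (\<lambda>z. fst z $ j) \<and> (\<integral>z. fst z $ j \<partial>P) = 0 \<and>
          integrable P (\<lambda>z. (fst z $ j)\<^sup>2) \<and> (\<integral>z. (fst z $ j)\<^sup>2 \<partial>P) = 1)"

definition bounded_data :: "((real ^ 'p) \<times> real) measure \<Rightarrow> real \<Rightarrow> real \<Rightarrow> bool" where
  "bounded_data P B\<^sub>Y B\<^sub>X \<longleftrightarrow>
     (AE z in P. \<bar>snd z\<bar> \<le> B\<^sub>Y \<and> (\<forall>j. \<bar>fst z $ j\<bar> \<le> B\<^sub>X))"

(* Only Y 1, ..., Y n are observed.  The last conjunct says that the labeled block is independent
   of the unlabeled block; it is phrased with the generated sigma-algebras because indep_var
   requires both random variables to have the same value type. *)
definition semi_supervised_sample ::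
    "'w measure \<Rightarrow> ((real ^ 'p) \<times> real) measure \<Rightarrow> nat \<Rightarrow> nat \<Rightarrow>
     (nat \<Rightarrow> 'w \<Rightarrow> real ^ 'p) \<Rightarrow> (nat \<Rightarrow> 'w \<Rightarrow> real) \<Rightarrow> bool" where
  "semi_supervised_sample M P n N X Y \<longleftrightarrow>
     prob_space.indep_vars M (\<lambda>_. borel) (\<lambda>i \<omega>. (X i \<omega>, Y i \<omega>)) {1..n} \<and>
     (\<forall>i\<in>{1..n}. distr M borel (\<lambda>\<omega>. (X i \<omega>, Y i \<omega>)) = P) \<and>
     prob_space.indep_vars M (\<lambda>_. borel) X {n+1..N} \<and>
     (\<forall>i\<in>{n+1..N}. distr M borel (X i) = marginal_X P) \<and>
     prob_space.indep_set M
       (sets (vimage_algebra (space M) (\<lambda>\<omega>. \<lambda>i\<in>{1..n}. (X i \<omega>, Y i \<omega>)) (\<Pi>\<^sub>M i\<in>{1..n}. borel)))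
       (sets (vimage_algebra (space M) (\<lambda>\<omega>. \<lambda>i\<in>{n+1..N}. X i \<omega>) (\<Pi>\<^sub>M i\<in>{n+1..N}. borel)))"

definition linear_predictor :: "real ^ 'p \<Rightarrow> real ^ 'p \<Rightarrow> real" where
  "linear_predictor \<beta> x = x \<bullet> \<beta>"

definition excess_risk ::
    "((real ^ 'p) \<times> real) measure \<Rightarrow> (real ^ 'p \<Rightarrow> real) \<Rightarrow> (real ^ 'p \<Rightarrow> real) \<Rightarrow> real" where
  "excess_risk P fstar f = (\<integral>x. (f x - fstar x)\<^sup>2 \<partial>marginal_X P)"

definition empirical_second_moment :: "nat \<Rightarrow> (nat \<Rightarrow> real ^ 'p) \<Rightarrow> real ^ 'p ^ 'p" where
  "empirical_second_moment N x = (1 / real N) *\<^sub>R (\<Sum>i=1..N. outer (x i))"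

definition lasso_objective ::
    "nat \<Rightarrow> nat \<Rightarrow> real \<Rightarrow> (nat \<Rightarrow> real ^ 'p) \<Rightarrow> (nat \<Rightarrow> real) \<Rightarrow> real ^ 'p \<Rightarrow> real" where
  "lasso_objective n N lam x y \<beta> =
     (norm (psd_sqrt (empirical_second_moment N x) *v \<beta>))\<^sup>2
     - 2 / real n * (\<Sum>i=1..n. y i * (x i \<bullet> \<beta>)) + 2 * lam * l1_norm \<beta>"

end

theory Submission
  imports Defs
begin

text \<open>
  Write \<open>u = \<beta>hat - \<beta>star\<close>, let \<open>J\<close> be the support of \<open>\<beta>star\<close> with complement \<open>Jc\<close>, let \<open>\<Sigma>\<close> be the
  population second moment matrix, \<open>A\<close> the empirical one over all \<open>N\<close> covariates, and \<open>b\<close> the average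
  of \<open>Y\<^sub>i X\<^sub>i\<close> over the labeled data. In a well specified model the excess risk is exactly \<open>u \<bullet> \<Sigma> u\<close>,
  so everything reduces to the estimation error \<open>u\<close>.

  Deterministic part. The smooth part of the lasso criterion is the quadratic
  \<open>\<beta> \<bullet> A \<beta> - 2 b \<bullet> \<beta>\<close>, so optimality of \<open>\<beta>hat\<close>, with the second order gain kept, bounds \<open>u \<bullet> A u\<close> by
  \<open>(b - A \<beta>star) \<bullet> u\<close> plus \<open>lam\<close> times the decrease of the l1-norm. If every coordinate of the noise
  \<open>b - A \<beta>star\<close> is below \<open>lam / 2\<close>, then (lemma \<open>lasso_cone\<close>)
  \<open>u \<bullet> A u < lam / 2 * (3 |u_J|\<^sub>1 - |u_Jc|\<^sub>1)\<close> unless \<open>u = 0\<close>. Thus \<open>u\<close> lies in the open cone of the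
  compatibility constant, and \<open>u \<bullet> A u\<close> is at most linear in \<open>|u_J|\<^sub>1\<close> although the constant makes it at
  least quadratic. This bounds the l1-norm of \<open>u\<close> (lemma \<open>l1_error_le_compatibility\<close>), hence the risk
  because the entries of \<open>\<Sigma>\<close> are at most 1; with the restricted eigenvalue, applied on the largest
  coordinates of \<open>u\<close>, it bounds the l2-norm (lemma \<open>l2_error_le_restricted_eigenvalue\<close>), hence the risk
  up to the spectral norm of \<open>\<Sigma>\<close>. If in addition \<open>A\<close> is entrywise close to \<open>\<Sigma>\<close>, then \<open>u \<bullet> \<Sigma> u\<close> exceeds
  \<open>u \<bullet> A u\<close> by at most a controlled fraction of itself, and the compatibility constant of \<open>\<Sigma>\<close> can be used
  (lemma \<open>prediction_error_le_population_compatibility\<close>).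

  Probabilistic part. A coordinate of the noise is a sum of \<open>N\<close> independent bounded terms: labeled
  ones contribute \<open>(Y\<^sub>i / n - X\<^sub>i \<bullet> \<beta>star / N) X\<^sub>i\<^sub>j\<close>, unlabeled ones \<open>- (X\<^sub>i \<bullet> \<beta>star / N) X\<^sub>i\<^sub>j\<close>.
  The means cancel, since \<open>E[Y X\<^sub>j] = E[(X \<bullet> \<beta>star) X\<^sub>j]\<close>, and the second moments add up to at most
  \<open>B\<^sub>Y\<^sup>2 / n\<close> (lemma \<open>noise_variance_le\<close>): estimating \<open>\<Sigma>\<close> by \<open>A\<close> adds nothing. Bernstein's inequality
  and a union bound over coordinates and signs make the noise small outside an event of probability
  \<open>\<delta> / 2\<close>. Hoeffding's inequality and a union bound over the entries control \<open>A - \<Sigma>\<close> outside another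
  such event.

  The square root of a positive semidefinite matrix is given by a definite
  description, so its existence and uniqueness are proved in order to rewrite \<open>|A\<^sup>1\<^sup>/\<^sup>2 v|\<^sup>2\<close> as \<open>v \<bullet> A v\<close>.
  And a probability of a set is meaningful only if the set is measurable; this holds because both
  constants are built from infima of functions that are continuous in the matrix.
\<close>

section \<open>Square roots of positive semidefinite matrices\<close>

lemma inner_matrix_symmetric:
  fixes A :: "real^'n^'n"
  assumes "transpose A = A"
  shows "v \<bullet> (A *v w) = (A *v v) \<bullet> w"
  by (metis assms dot_lmul_matrix transpose_matrix_vector)

lemma outer_mult_vec: "outer v *v x = (v \<bullet> x) *\<^sub>R v"
  by (simp add: outer_def matrix_vector_mult_def vec_eq_iff inner_vec_def sum_distrib_left
      sum_distrib_right mult_ac)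

lemma transpose_outer [simp]: "transpose (outer v) = outer v"
  by (simp add: outer_def transpose_def vec_eq_iff mult.commute)

lemma psd_symmetric: "psd A \<Longrightarrow> transpose A = A"
  by (simp add: psd_def)

lemma psd_nonneg: "psd A \<Longrightarrow> 0 \<le> v \<bullet> (A *v v)"
  by (simp add: psd_def)

lemma transpose_add: "transpose (A + B) = transpose A + transpose B"
  by (simp add: transpose_def vec_eq_iff)

lemma transpose_diff: "transpose (A - B) = transpose A - transpose B"
  by (simp add: transpose_def vec_eq_iff)

lemma psd_add: "psd A \<Longrightarrow> psd B \<Longrightarrow> psd (A + B)"
  by (simp add: psd_def transpose_add matrix_vector_mult_add_rdistrib inner_add_right)

lemma psd_scaleR: "psd A \<Longrightarrow> 0 \<le> c \<Longrightarrow> psd (c *\<^sub>R A)"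
  by (simp add: psd_def transpose_scalar scaleR_matrix_vector_assoc[symmetric])

lemma psd_zero [simp]: "psd 0"
  by (simp add: psd_def transpose_def vec_eq_iff)

lemma psd_outer: "psd (outer v)"
  by (simp add: psd_def outer_mult_vec inner_commute)

text \<open>
  At \<open>v + t *\<^sub>R (B *v v)\<close> the form takes the value \<open>2 * t * |B v|\<^sup>2\<close> up to a term of order \<open>t\<^sup>2\<close>, which
  would be negative for small negative \<open>t\<close> if \<open>B *v v\<close> were nonzero.
\<close>

lemma psd_isotropic_imp_kernel:
  assumes "psd B" and "v \<bullet> (B *v v) = 0"
  shows "B *v v = 0"
proof (rule ccontr)
  assume nz: "B *v v \<noteq> 0"
  define w where "w = B *v v"
  define p where "p = w \<bullet> w"
  define q where "q = w \<bullet> (B *v w)"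
  have p: "0 < p" using nz by (simp add: p_def w_def)
  have q: "0 \<le> q" using assms(1) by (simp add: q_def psd_nonneg)
  \<comment> \<open>The minimiser \<open>- p / q\<close> of \<open>2 t p + t\<^sup>2 q\<close>, with the denominator kept away from 0.\<close>
  define t where "t = - p / (q + 1)"
  have vw: "v \<bullet> w = 0" using assms(2) by (simp add: w_def)
  have vBw: "v \<bullet> (B *v w) = p"
    unfolding p_def inner_matrix_symmetric[OF psd_symmetric[OF assms(1)], of v w] by (simp add: w_def)
  have Bvt: "B *v (v + t *\<^sub>R w) = w + t *\<^sub>R (B *v w)"
    by (simp add: matrix_vector_right_distrib matrix_vector_mult_scaleR w_def)
  have "0 \<le> (v + t *\<^sub>R w) \<bullet> (B *v (v + t *\<^sub>R w))"
    using assms(1) by (rule psd_nonneg)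
  also have "\<dots> = 2 * t * p + t\<^sup>2 * q"
    unfolding Bvt inner_add_left inner_add_right inner_scaleR_left inner_scaleR_right vw vBw
    by (simp add: p_def q_def power2_eq_square algebra_simps)
  also have "\<dots> = - (p\<^sup>2 * (q + 2)) / (q + 1)\<^sup>2"
  proof -
    have "t * (q + 1) = - p" using q by (simp add: t_def)
    then have "(2 * t * p + t\<^sup>2 * q) * (q + 1)\<^sup>2 = - (p\<^sup>2 * (q + 2))"
      by algebra
    then show ?thesis using q by (simp add: field_simps)
  qed
  also have "\<dots> < 0"
    using p q by (simp add: divide_neg_pos)
  finally show False by simp
qed

text \<open>
  Maximise \<open>v \<bullet> (A *v v)\<close> over the unit sphere. If \<open>\<mu>\<close> is the maximum, then \<open>\<mu> I - A\<close> is positive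
  semidefinite and its form vanishes at the maximiser, which therefore lies in its kernel.
\<close>

lemma psd_top_eigenvector:
  fixes A :: "real^'n^'n"
  assumes "psd A" and "A \<noteq> 0"
  obtains \<mu> v where "0 < \<mu>" "norm v = 1" "A *v v = \<mu> *\<^sub>R v"
proof -
  define S where "S = sphere (0::real^'n) 1"
  have "S \<noteq> {}" unfolding S_def by simp
  moreover have "compact S" unfolding S_def by simp
  moreover have "continuous_on S (\<lambda>v. v \<bullet> (A *v v))"
    by (intro continuous_intros linear_continuous_on) 
  ultimately obtain v where v: "v \<in> S" and max: "\<And>w. w \<in> S \<Longrightarrow> w \<bullet> (A *v w) \<le> v \<bullet> (A *v v)"
    using continuous_attains_sup[of S "\<lambda>v. v \<bullet> (A *v v)"] by blast
  define \<mu> where "\<mu> = v \<bullet> (A *v v)"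
  have nv: "norm v = 1" using v by (simp add: S_def)
  have bound: "w \<bullet> (A *v w) \<le> \<mu> * (w \<bullet> w)" for w
  proof (cases "w = 0")
    case False
    define u where "u = (1 / norm w) *\<^sub>R w"
    have "u \<in> S" using False by (simp add: u_def S_def)
    then have "u \<bullet> (A *v u) \<le> \<mu>" using max by (simp add: \<mu>_def)
    then have "w \<bullet> (A *v w) / (norm w)\<^sup>2 \<le> \<mu>"
      by (simp add: u_def matrix_vector_mult_scaleR power2_eq_square)
    then show ?thesis
      using False by (simp add: pos_divide_le_eq dot_square_norm)
  qed simp
  define C where "C = \<mu> *\<^sub>R mat 1 - A"
  have Cv: "C *v w = \<mu> *\<^sub>R w - A *v w" for w
    by (simp add: C_def matrix_vector_mult_diff_rdistrib scaleR_matrix_vector_assoc[symmetric])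
  have "psd C"
    unfolding psd_def
  proof (intro conjI allI)
    show "transpose C = C"
      using psd_symmetric[OF assms(1)] by (simp add: C_def transpose_diff transpose_scalar)
    show "0 \<le> w \<bullet> (C *v w)" for w
      using bound[of w] by (simp add: Cv inner_diff_right)
  qed
  moreover have "v \<bullet> (C *v v) = 0"
    using nv by (simp add: Cv inner_diff_right \<mu>_def dot_square_norm)
  ultimately have "C *v v = 0" by (rule psd_isotropic_imp_kernel)
  then have eig: "A *v v = \<mu> *\<^sub>R v" by (simp add: Cv)
  have "\<mu> \<noteq> 0"
  proof
    assume "\<mu> = 0"
    then have "w \<bullet> (A *v w) = 0" for w
      using bound[of w] psd_nonneg[OF assms(1), of w] by simp
    then have "A *v w = 0" for w using psd_isotropic_imp_kernel[OF assms(1)] by blast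
    then have "A = 0" by (simp add: matrix_eq)
    then show False using assms(2) by simp
  qed
  moreover have "0 \<le> \<mu>" using psd_nonneg[OF assms(1)] by (simp add: \<mu>_def)
  ultimately have "0 < \<mu>" by simp
  then show ?thesis using nv eig by (rule that)
qed

text \<open>
  Deflation: subtracting \<open>\<mu> v v\<^sup>T\<close> for a unit eigenvector \<open>v\<close> keeps the matrix positive semidefinite and
  enlarges its kernel. A root of the remainder annihilates \<open>v\<close>, so adding \<open>sqrt \<mu> v v\<^sup>T\<close> to it produces
  no cross terms in the square.
\<close>

lemma psd_sqrt_exists:
  fixes A :: "real^'n^'n"
  assumes "psd A"
  shows "\<exists>B. psd B \<and> B ** B = A"
  using assms
proof (induction "CARD('n) - dim {x. A *v x = 0}" arbitrary: A rule: less_induct)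
  case less
  show ?case
  proof (cases "A = 0")
    case True
    then show ?thesis by (intro exI[of _ 0]) simp
  next
    case False
    obtain \<mu> v where \<mu>: "0 < \<mu>" and nv: "norm v = 1" and eig: "A *v v = \<mu> *\<^sub>R v"
      using psd_top_eigenvector[OF less.prems False] .
    have vv: "v \<bullet> v = 1" using nv by (simp add: dot_square_norm)
    note sym = inner_matrix_symmetric[OF psd_symmetric[OF less.prems]]
    define A' where "A' = A - \<mu> *\<^sub>R outer v"
    have A'v: "A' *v w = A *v w - (\<mu> * (v \<bullet> w)) *\<^sub>R v" for w
      by (simp add: A'_def matrix_vector_mult_diff_rdistrib scaleR_matrix_vector_assoc[symmetric] outer_mult_vec)
    have psdA': "psd A'"
      unfolding psd_def
    proof (intro conjI allI)
      show "transpose A' = A'"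
        using psd_symmetric[OF less.prems] by (simp add: A'_def transpose_diff transpose_scalar)
      fix w
      define z where "z = w - (v \<bullet> w) *\<^sub>R v"
      have "z \<bullet> (A *v z) = w \<bullet> (A *v w) - (v \<bullet> w) * (w \<bullet> (A *v v)) - (v \<bullet> w) * (v \<bullet> (A *v w))
              + (v \<bullet> w)\<^sup>2 * (v \<bullet> (A *v v))"
        by (simp add: z_def matrix_vector_mult_diff_distrib matrix_vector_mult_scaleR inner_diff_left
            inner_diff_right power2_eq_square algebra_simps)
      also have "v \<bullet> (A *v w) = \<mu> * (v \<bullet> w)" by (simp add: sym eig)
      finally have "w \<bullet> (A' *v w) = z \<bullet> (A *v z)"
        by (simp add: A'v eig vv inner_diff_right inner_commute[of w v] power2_eq_square)
      then show "0 \<le> w \<bullet> (A' *v w)" using psd_nonneg[OF less.prems] by simp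
    qed
    have A'v0: "A' *v v = 0" by (simp add: A'v eig vv)
    have sub: "subspace {x. A *v x = 0}" "subspace {x. A' *v x = 0}"
      by (auto simp: subspace_def matrix_vector_right_distrib matrix_vector_mult_scaleR)
    have "{x. A *v x = 0} \<subset> {x. A' *v x = 0}"
    proof
      show "{x. A *v x = 0} \<subseteq> {x. A' *v x = 0}"
      proof clarify
        fix x assume "A *v x = 0"
        moreover from this have "\<mu> * (v \<bullet> x) = 0" using sym[of v x] by (simp add: eig)
        ultimately show "A' *v x = 0" by (simp add: A'v)
      qed
      have "v \<noteq> 0" using nv by auto
      then have "A *v v \<noteq> 0" using \<mu> eig by simp
      then show "{x. A *v x = 0} \<noteq> {x. A' *v x = 0}" using A'v0 by blast
    qed
    then have "dim {x. A *v x = 0} < dim {x. A' *v x = 0}"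
      using sub by (metis dim_psubset span_eq_iff)
    moreover have "dim {x. A' *v x = 0} \<le> CARD('n)"
      using dim_subset_UNIV_cart by blast
    ultimately have "CARD('n) - dim {x. A' *v x = 0} < CARD('n) - dim {x. A *v x = 0}"
      by linarith
    from less.hyps[OF this psdA'] obtain B' where B': "psd B'" "B' ** B' = A'"
      by blast
    have "(B' *v v) \<bullet> (B' *v v) = v \<bullet> ((B' ** B') *v v)"
      unfolding matrix_vector_mul_assoc[symmetric]
      by (rule inner_matrix_symmetric[OF psd_symmetric[OF B'(1)], symmetric])
    then have B'v: "B' *v v = 0" by (simp add: B' A'v0)
    define B where "B = B' + sqrt \<mu> *\<^sub>R outer v"
    have Bv: "B *v w = B' *v w + (sqrt \<mu> * (v \<bullet> w)) *\<^sub>R v" for w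
      by (simp add: B_def matrix_vector_mult_add_rdistrib scaleR_matrix_vector_assoc[symmetric] outer_mult_vec)
    have "B ** B = A"
    proof (subst matrix_eq, intro allI)
      fix w
      have "v \<bullet> (B' *v w) = 0"
        using inner_matrix_symmetric[OF psd_symmetric[OF B'(1)], of v w] by (simp add: B'v)
      then have "(B ** B) *v w = (B' ** B') *v w + (\<mu> * (v \<bullet> w)) *\<^sub>R v"
        using \<mu> by (simp add: Bv matrix_vector_mul_assoc[symmetric] matrix_vector_right_distrib
            matrix_vector_mult_scaleR B'v inner_add_right vv)
      then show "(B ** B) *v w = A *v w" by (simp add: B' A'v)
    qed
    moreover have "psd B"
      unfolding B_def using \<mu> by (intro psd_add psd_scaleR psd_outer B') simp
    ultimately show ?thesis by (intro exI[of _ B] conjI)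
  qed
qed

text \<open>
  Writes the trace through values of the quadratic form of \<open>B\<close>, so that its sign can be read off.
\<close>

lemma trace_congruence_eq_sum:
  fixes B D :: "real^'n^'n"
  assumes "transpose D = D"
  shows "trace (D ** B ** D) = (\<Sum>i\<in>UNIV. (D *v axis i 1) \<bullet> (B *v (D *v axis i 1)))"
proof -
  have "(D *v axis i 1) \<bullet> (B *v (D *v axis i 1)) = axis i 1 \<bullet> ((D ** B ** D) *v axis i 1)" for i
    by (metis assms inner_matrix_symmetric matrix_vector_mul_assoc)
  then show ?thesis
    by (simp add: trace_def inner_axis' matrix_vector_mult_basis column_def)
qed

text \<open>
  For \<open>D = B - C\<close> the hypothesis gives \<open>B D = - D C\<close>, hence \<open>tr (D B D) = - tr (D C D)\<close> by cyclicity
  of the trace. Both traces are nonnegative, so both vanish and \<open>B\<close> and \<open>C\<close> annihilate the range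
  of \<open>D\<close>; then \<open>D\<^sup>2 = 0\<close> and, by symmetry, \<open>D = 0\<close>.
\<close>

lemma psd_sqrt_unique:
  fixes B C :: "real^'n^'n"
  assumes B: "psd B" and C: "psd C" and eq: "B ** B = C ** C"
  shows "B = C"
proof -
  define D where "D = B - C"
  have D: "transpose D = D"
    using B C by (simp add: D_def psd_symmetric transpose_diff)
  have BD: "B ** D + D ** C = 0"
    using eq
    by (simp add: matrix_eq matrix_vector_mul_assoc[symmetric] D_def matrix_vector_mult_diff_rdistrib
        matrix_vector_mult_diff_distrib matrix_vector_mult_add_rdistrib)
  have "trace (D ** B ** D) + trace (D ** C ** D) = trace (D ** B ** D) + trace (D ** (D ** C))"
    by (metis trace_mul_sym)
  also have "\<dots> = trace (D ** (B ** D + D ** C))"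
    by (simp add: matrix_mul_assoc matrix_add_ldistrib trace_add)
  also have "\<dots> = 0"
    unfolding BD by (simp add: trace_def matrix_matrix_mult_def)
  finally have tr: "trace (D ** B ** D) + trace (D ** C ** D) = 0" by simp
  have nonneg: "0 \<le> (D *v axis i 1) \<bullet> (E *v (D *v axis i 1))" if "psd E" for E i
    using that by (rule psd_nonneg)
  have zero: "E *v (D *v axis i 1) = 0" if "E = B \<or> E = C" for E i
  proof (rule psd_isotropic_imp_kernel)
    show "psd E" using that B C by auto
    have s0: "0 \<le> trace (D ** B ** D)" "0 \<le> trace (D ** C ** D)"
      unfolding trace_congruence_eq_sum[OF D] using B C by (auto intro!: sum_nonneg nonneg)
    with tr have "trace (D ** E ** D) = 0" using that by auto
    then show "(D *v axis i 1) \<bullet> (E *v (D *v axis i 1)) = 0"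
      unfolding trace_congruence_eq_sum[OF D]
      using nonneg[OF \<open>psd E\<close>] by (subst (asm) sum_nonneg_eq_0_iff) auto
  qed
  have "D *v axis i 1 = 0" for i
  proof -
    have "(D *v axis i 1) \<bullet> (D *v axis i 1) = axis i 1 \<bullet> (D *v (D *v axis i 1))"
      by (rule inner_matrix_symmetric[OF D, symmetric])
    also have "D *v (D *v axis i 1) = 0"
      using zero[of B i] zero[of C i]
      by (subst D_def) (simp add: matrix_vector_mult_diff_rdistrib)
    finally show ?thesis by simp
  qed
  then have "D = 0"
    by (simp add: matrix_vector_mult_basis column_def vec_eq_iff)
  then show ?thesis by (simp add: D_def)
qed

lemma norm_psd_sqrt:
  assumes "psd A"
  shows "(norm (psd_sqrt A *v v))\<^sup>2 = v \<bullet> (A *v v)"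
proof -
  have "\<exists>!B. psd B \<and> B ** B = A"
  proof (rule ex_ex1I)
    show "\<exists>B. psd B \<and> B ** B = A" by (rule psd_sqrt_exists[OF assms])
    fix B C assume "psd B \<and> B ** B = A" and "psd C \<and> C ** C = A"
    then show "B = C" using psd_sqrt_unique[of B C] by metis
  qed
  from theI'[OF this] have R: "psd (psd_sqrt A)" "psd_sqrt A ** psd_sqrt A = A"
    unfolding psd_sqrt_def by (rule conjunct1, rule conjunct2)
  have "(norm (psd_sqrt A *v v))\<^sup>2 = v \<bullet> (psd_sqrt A *v (psd_sqrt A *v v))"
    unfolding power2_norm_eq_inner by (rule inner_matrix_symmetric[OF psd_symmetric[OF R(1)], symmetric])
  also have "psd_sqrt A *v (psd_sqrt A *v v) = (psd_sqrt A ** psd_sqrt A) *v v"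
    by (rule matrix_vector_mul_assoc)
  also have "\<dots> = A *v v"
    by (rule arg_cong[OF R(2), of "\<lambda>B. B *v v"])
  finally show ?thesis .
qed

section \<open>Sparse vectors and quadratic forms\<close>

lemma empirical_second_moment_nth:
  "empirical_second_moment N x $ j $ k = (\<Sum>i=1..N. x i $ j * x i $ k) / real N"
  by (simp add: empirical_second_moment_def outer_def)

lemma empirical_second_moment_mult:
  "empirical_second_moment N x *v \<beta> = (1 / real N) *\<^sub>R (\<Sum>i=1..N. (x i \<bullet> \<beta>) *\<^sub>R x i)"
proof -
  have "(\<Sum>i=1..m. outer (x i)) *v \<beta> = (\<Sum>i=1..m. (x i \<bullet> \<beta>) *\<^sub>R x i)" for m
    by (induction m) (simp_all add: matrix_vector_mult_add_rdistrib outer_mult_vec)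
  then show ?thesis
    by (simp add: empirical_second_moment_def scaleR_matrix_vector_assoc[symmetric])
qed

lemma psd_empirical_second_moment: "psd (empirical_second_moment N x)"
proof -
  have "psd (\<Sum>i=1..m. outer (x i))" for m
    by (induction m) (simp_all add: psd_add psd_outer)
  then show ?thesis unfolding empirical_second_moment_def by (intro psd_scaleR) auto
qed

lemma l1_norm_nonneg [simp]: "0 \<le> l1_norm v"
  by (simp add: l1_norm_def sum_nonneg)

lemma l1_norm_eq_0_iff [simp]: "l1_norm v = 0 \<longleftrightarrow> v = 0"
  by (simp add: l1_norm_def sum_nonneg_eq_0_iff vec_eq_iff)

lemma l1_norm_restrict: "l1_norm (restrict_vec J v) = (\<Sum>j\<in>J. \<bar>v $ j\<bar>)"
  by (simp add: l1_norm_def restrict_vec_def if_distrib[of abs] sum.If_cases cong: if_cong)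

lemma l1_norm_split: "l1_norm v = l1_norm (restrict_vec J v) + l1_norm (restrict_vec (- J) v)"
  unfolding l1_norm_restrict
  by (simp add: l1_norm_def sum.subset_diff[of J UNIV] Compl_eq_Diff_UNIV add.commute)

lemma norm_restrict_squared: "(norm (restrict_vec J v))\<^sup>2 = (\<Sum>j\<in>J. (v $ j)\<^sup>2)"
  unfolding power2_norm_eq_inner inner_vec_def restrict_vec_def
  by (simp add: if_distrib[of "\<lambda>x. x\<^sup>2"] sum.If_cases flip: power2_eq_square cong: if_cong)

lemma norm_squared_split:
  "(norm v)\<^sup>2 = (norm (restrict_vec J v))\<^sup>2 + (norm (restrict_vec (- J) v))\<^sup>2"
proof -
  have "(norm v)\<^sup>2 = (\<Sum>j\<in>UNIV. (v $ j)\<^sup>2)"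
    by (simp add: power2_norm_eq_inner inner_vec_def flip: power2_eq_square)
  then show ?thesis
    unfolding norm_restrict_squared
    by (simp add: sum.subset_diff[of J UNIV] Compl_eq_Diff_UNIV add.commute)
qed

lemma restrict_vec_scaleR: "restrict_vec J (c *\<^sub>R v) = c *\<^sub>R restrict_vec J v"
  by (simp add: restrict_vec_def vec_eq_iff)

lemma l1_norm_scaleR: "l1_norm (c *\<^sub>R v) = \<bar>c\<bar> * l1_norm v"
  by (simp add: l1_norm_def abs_mult sum_distrib_left)

lemma l1_norm_triangle: "l1_norm (v + w) \<le> l1_norm v + l1_norm w"
  by (simp add: l1_norm_def sum.distrib[symmetric] sum_mono)

text \<open>
  The Cauchy-Schwarz inequality against the indicator of \<open>J\<close>.
\<close>

lemma l1_norm_restrict_le: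
  "l1_norm (restrict_vec J v) \<le> sqrt (real (card J)) * norm (restrict_vec J v)"
proof (rule power2_le_imp_le)
  show "(l1_norm (restrict_vec J v))\<^sup>2 \<le> (sqrt (real (card J)) * norm (restrict_vec J v))\<^sup>2"
    using Cauchy_Schwarz_ineq_sum[of "\<lambda>_. 1" "\<lambda>j. \<bar>v $ j\<bar>" J]
    by (simp add: l1_norm_restrict power_mult_distrib norm_restrict_squared)
qed simp

lemma quadratic_form_sum: "v \<bullet> (A *v v) = (\<Sum>j\<in>UNIV. \<Sum>k\<in>UNIV. A $ j $ k * (v $ j * v $ k))"
  for A :: "real^'n^'n"
  by (simp add: inner_vec_def matrix_vector_mult_def sum_distrib_left mult_ac)

lemma quadratic_form_le_l1:
  fixes A :: "real^'n^'n"
  assumes "\<And>j k. \<bar>A $ j $ k\<bar> \<le> c"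
  shows "v \<bullet> (A *v v) \<le> c * (l1_norm v)\<^sup>2"
proof -
  have "v \<bullet> (A *v v) \<le> (\<Sum>j\<in>UNIV. \<Sum>k\<in>UNIV. c * (\<bar>v $ j\<bar> * \<bar>v $ k\<bar>))"
    unfolding quadratic_form_sum
  proof (intro sum_mono)
    fix j k
    have "A $ j $ k * (v $ j * v $ k) \<le> \<bar>A $ j $ k\<bar> * (\<bar>v $ j\<bar> * \<bar>v $ k\<bar>)"
      by (metis abs_ge_self abs_mult)
    also have "\<dots> \<le> c * (\<bar>v $ j\<bar> * \<bar>v $ k\<bar>)"
      using assms by (intro mult_right_mono) auto
    finally show "A $ j $ k * (v $ j * v $ k) \<le> c * (\<bar>v $ j\<bar> * \<bar>v $ k\<bar>)" .
  qed
  also have "\<dots> = c * (l1_norm v)\<^sup>2"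
    unfolding l1_norm_def power2_eq_square sum_product by (simp add: sum_distrib_left)
  finally show ?thesis .
qed

section \<open>Optimality of the lasso\<close>

text \<open>
  Moving from the minimiser \<open>h\<close> a fraction \<open>t\<close> towards \<open>w\<close> changes the smooth part by a quadratic
  polynomial in \<open>t\<close> and, by convexity, the penalty by at most \<open>t\<close> times the difference of the
  penalties. The first order condition at \<open>t = 0\<close> keeps the full curvature term on the left; comparing
  only the values at \<open>h\<close> and \<open>w\<close> would lose a factor 2.
\<close>

lemma lasso_variational_inequality:
  fixes A :: "real^'n^'n"
  assumes A: "psd A" and "0 \<le> lam"
    and min: "\<And>w. h \<bullet> (A *v h) - 2 * (b \<bullet> h) + 2 * lam * l1_norm h
                   \<le> w \<bullet> (A *v w) - 2 * (b \<bullet> w) + 2 * lam * l1_norm w"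
  shows "(h - w) \<bullet> (A *v (h - w)) \<le> (b - A *v w) \<bullet> (h - w) + lam * (l1_norm w - l1_norm h)"
proof -
  define u where "u = h - w"
  define q where "q = u \<bullet> (A *v u)"
  define x where "x = h \<bullet> (A *v u) - b \<bullet> u - lam * (l1_norm w - l1_norm h)"
  have q: "0 \<le> q" using A by (simp add: q_def psd_nonneg)
  have sym: "u \<bullet> (A *v h) = h \<bullet> (A *v u)"
    using inner_matrix_symmetric[OF psd_symmetric[OF A], of u h] by (simp add: inner_commute)
  have step: "2 * x \<le> t * q" if t: "0 < t" "t \<le> 1" for t
  proof -
    have "h - t *\<^sub>R u = (1 - t) *\<^sub>R h + t *\<^sub>R w"
      by (simp add: u_def algebra_simps)
    then have "l1_norm (h - t *\<^sub>R u) \<le> l1_norm ((1 - t) *\<^sub>R h) + l1_norm (t *\<^sub>R w)"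
      by (simp only: l1_norm_triangle)
    also have "\<dots> = l1_norm h + t * (l1_norm w - l1_norm h)"
      using t unfolding l1_norm_scaleR by (simp add: algebra_simps)
    finally have "lam * l1_norm (h - t *\<^sub>R u) \<le> lam * (l1_norm h + t * (l1_norm w - l1_norm h))"
      using \<open>0 \<le> lam\<close> by (rule mult_left_mono)
    moreover have "(h - t *\<^sub>R u) \<bullet> (A *v (h - t *\<^sub>R u))
        = h \<bullet> (A *v h) - 2 * t * (h \<bullet> (A *v u)) + t\<^sup>2 * q"
      by (simp add: matrix_vector_mult_diff_distrib matrix_vector_mult_scaleR inner_diff_left
          inner_diff_right sym q_def power2_eq_square algebra_simps)
    ultimately have "0 \<le> t * (t * q - 2 * x)"
      using min[of "h - t *\<^sub>R u"]
      by (simp add: x_def inner_diff_right power2_eq_square algebra_simps)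
    then show ?thesis using t by (simp add: zero_le_mult_iff)
  qed
  have "x \<le> 0"
  proof (rule ccontr)
    assume "\<not> x \<le> 0"
    then have x: "0 < x" by simp
    \<comment> \<open>Small enough that the curvature term \<open>t * q\<close> stays below \<open>x\<close>, contradicting \<open>2 * x \<le> t * q\<close>.\<close>
    define t where "t = min 1 (x / (q + 1))"
    have "0 < t" "t \<le> 1" using x q by (auto simp: t_def)
    then have "2 * x \<le> t * q" by (rule step)
    also have "\<dots> \<le> x / (q + 1) * q"
      using q by (intro mult_right_mono) (auto simp: t_def)
    also have "\<dots> \<le> x"
      using q x by (simp add: divide_simps)
    finally show False using x by simp
  qed
  moreover have "h \<bullet> (A *v u) = u \<bullet> (A *v u) + (A *v w) \<bullet> u"
    using inner_matrix_symmetric[OF psd_symmetric[OF A], of w u]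
    by (simp add: u_def inner_diff_left)
  ultimately show ?thesis
    by (simp add: x_def inner_diff_left u_def)
qed

text \<open>
  Off the support \<open>J\<close> of \<open>w\<close> the error equals \<open>h\<close>, so the penalty difference is at most
  \<open>|u_J|\<^sub>1 - |u_Jc|\<^sub>1\<close>, while the noise term is less than \<open>lam / 2 * |u|\<^sub>1\<close>. Strictness matters:
  it places the error in the open cone that defines the compatibility constant.
\<close>

lemma lasso_cone:
  fixes A :: "real^'n^'n"
  assumes A: "psd A" and lam: "0 < lam"
    and min: "\<And>w. h \<bullet> (A *v h) - 2 * (b \<bullet> h) + 2 * lam * l1_norm h
                   \<le> w \<bullet> (A *v w) - 2 * (b \<bullet> w) + 2 * lam * l1_norm w"
    and noise: "\<And>j. \<bar>(b - A *v w) $ j\<bar> < lam / 2"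
    and J: "J = {j. w $ j \<noteq> 0}"
    and neq: "h \<noteq> w"
  shows "(h - w) \<bullet> (A *v (h - w))
    < lam / 2 * (3 * l1_norm (restrict_vec J (h - w)) - l1_norm (restrict_vec (- J) (h - w)))"
proof -
  define u where "u = h - w"
  obtain j0 where j0: "u $ j0 \<noteq> 0" using neq by (auto simp: u_def vec_eq_iff)
  have "(b - A *v w) \<bullet> u \<le> (\<Sum>j\<in>UNIV. \<bar>(b - A *v w) $ j\<bar> * \<bar>u $ j\<bar>)"
    unfolding inner_vec_def by (intro sum_mono) (simp add: abs_mult[symmetric])
  also have "\<dots> < (\<Sum>j\<in>UNIV. lam / 2 * \<bar>u $ j\<bar>)"
  proof (rule sum_strict_mono_ex1)
    show "\<forall>j\<in>UNIV. \<bar>(b - A *v w) $ j\<bar> * \<bar>u $ j\<bar> \<le> lam / 2 * \<bar>u $ j\<bar>"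
      using noise by (intro ballI mult_right_mono less_imp_le abs_ge_zero)
    show "\<exists>j\<in>UNIV. \<bar>(b - A *v w) $ j\<bar> * \<bar>u $ j\<bar> < lam / 2 * \<bar>u $ j\<bar>"
      using noise[of j0] j0 by (intro bexI[of _ j0] mult_strict_right_mono) auto
  qed simp
  also have "\<dots> = lam / 2 * (l1_norm (restrict_vec J u) + l1_norm (restrict_vec (- J) u))"
    unfolding l1_norm_split[symmetric] by (simp add: l1_norm_def sum_distrib_left)
  finally have n: "(b - A *v w) \<bullet> u < \<dots>" .
  have "l1_norm w - l1_norm h \<le> l1_norm (restrict_vec J u) - l1_norm (restrict_vec (- J) u)"
  proof -
    have "l1_norm (restrict_vec (- J) h) = l1_norm (restrict_vec (- J) u)"
      unfolding l1_norm_restrict by (intro sum.cong) (auto simp: J u_def)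
    moreover have "l1_norm (restrict_vec (- J) w) = 0"
      unfolding l1_norm_restrict by (auto simp: J)
    moreover have "l1_norm (restrict_vec J w)
        \<le> l1_norm (restrict_vec J h) + l1_norm (restrict_vec J u)"
      unfolding l1_norm_restrict sum.distrib[symmetric] by (intro sum_mono) (auto simp: u_def)
    ultimately show ?thesis
      using l1_norm_split[of w J] l1_norm_split[of h J] by linarith
  qed
  then have "lam * (l1_norm w - l1_norm h)
      \<le> lam * (l1_norm (restrict_vec J u) - l1_norm (restrict_vec (- J) u))"
    using lam by (intro mult_left_mono) auto
  moreover have "u \<bullet> (A *v u) \<le> (b - A *v w) \<bullet> u + lam * (l1_norm w - l1_norm h)"
    unfolding u_def using lam by (intro lasso_variational_inequality[OF A _ min]) simp
  ultimately have "u \<bullet> (A *v u)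
    < lam / 2 * (3 * l1_norm (restrict_vec J u) - l1_norm (restrict_vec (- J) u))"
    using n by (simp add: algebra_simps)
  then show ?thesis by (simp add: u_def)
qed

section \<open>Estimation error under restricted eigenvalue conditions\<close>

lemma compatibility_quadratic:
  assumes "psd A"
  shows "compatibility A J c =
     (INF v \<in> {v. l1_norm (restrict_vec (- J) v) < c * l1_norm (restrict_vec J v)}.
        ereal (real (card J) * (v \<bullet> (A *v v)) / (l1_norm (restrict_vec J v))\<^sup>2))"
  by (simp add: compatibility_def norm_psd_sqrt[OF assms])

lemma compatibility_nonneg: "0 \<le> compatibility A J c"
  unfolding compatibility_def by (intro INF_greatest) simp

lemma compatibility_le:
  assumes "psd A" and "l1_norm (restrict_vec (- J) v) < c * l1_norm (restrict_vec J v)"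
  shows "compatibility A J c
    \<le> ereal (real (card J) * (v \<bullet> (A *v v)) / (l1_norm (restrict_vec J v))\<^sup>2)"
  unfolding compatibility_quadratic[OF assms(1)] using assms(2) by (intro INF_lower) simp

text \<open>
  The existence of a nonzero vector in the cone excludes the empty infimum, so the constant is a
  real number and the quadratic lower bound can be used without extended arithmetic.
\<close>

lemma compatibility_cone_real:
  fixes A :: "real^'n^'n"
  assumes "psd A" and "l1_norm (restrict_vec (- J) v) < 3 * l1_norm (restrict_vec J v)"
  obtains k where "compatibility A J 3 = ereal k" "0 \<le> k"
    "k * (l1_norm (restrict_vec J v))\<^sup>2 \<le> real (card J) * (v \<bullet> (A *v v))"
    "0 < card J" "0 < l1_norm (restrict_vec J v)"
proof -
  have "0 \<le> l1_norm (restrict_vec (- J) v)" by simp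
  with assms(2) have a: "0 < l1_norm (restrict_vec J v)" by linarith
  then have "J \<noteq> {}" by (auto simp: l1_norm_restrict)
  then have c: "0 < card J" by (simp add: card_gt_0_iff)
  note le = compatibility_le[OF assms]
  have "0 \<le> compatibility A J 3" by (rule compatibility_nonneg)
  with le obtain k where k: "compatibility A J 3 = ereal k" "0 \<le> k"
    by (cases "compatibility A J 3") auto
  have "0 < (l1_norm (restrict_vec J v))\<^sup>2" using a by (rule zero_less_power)
  then have "k * (l1_norm (restrict_vec J v))\<^sup>2 \<le> real (card J) * (v \<bullet> (A *v v))"
    using le by (simp only: k ereal_less_eq pos_le_divide_eq)
  then show ?thesis using that k c a by blast
qed

text \<open>
  With \<open>a\<close> the l1-norm of \<open>u\<close> on \<open>J\<close>, the compatibility constant \<open>k\<close> gives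
  \<open>k a\<^sup>2 \<le> |J| (u \<bullet> A u) \<le> 3/2 lam |J| a\<close>, hence a bound on \<open>a\<close>, and the cone gives \<open>|u|\<^sub>1 \<le> 4 a\<close>.
\<close>

lemma l1_error_le_compatibility:
  fixes A :: "real^'n^'n"
  assumes A: "psd A" and lam: "0 < lam"
    and cone: "u \<bullet> (A *v u) < lam / 2 * (3 * l1_norm (restrict_vec J u) - l1_norm (restrict_vec (- J) u))"
  shows "ereal ((l1_norm u)\<^sup>2) \<le> (ereal (6 * lam * real (card J)) / compatibility A J 3)\<^sup>2"
proof -
  define a where "a = l1_norm (restrict_vec J u)"
  define b where "b = l1_norm (restrict_vec (- J) u)"
  define q where "q = u \<bullet> (A *v u)"
  have q: "0 \<le> q" using A by (simp add: q_def psd_nonneg)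
  have qab: "q < lam / 2 * (3 * a - b)" using cone by (simp add: q_def a_def b_def)
  with q have "0 < lam / 2 * (3 * a - b)" by linarith
  with lam have ab: "b < 3 * a" by (simp add: zero_less_mult_iff)
  have b: "0 \<le> b" by (simp add: b_def)
  obtain k where k: "compatibility A J 3 = ereal k" "0 \<le> k" "k * a\<^sup>2 \<le> real (card J) * q"
    "0 < card J" "0 < a"
    using compatibility_cone_real[OF A, of J u] ab unfolding a_def b_def q_def by blast
  show ?thesis
  proof (cases "k = 0")
    case True
    then show ?thesis using lam k(4) by (auto simp: k(1) power2_eq_square card_gt_0_iff)
  next
    case False
    then have kpos: "0 < k" using k(2) by simp
    have "lam / 2 * (3 * a - b) \<le> lam / 2 * (3 * a)"
      using lam b by (intro mult_left_mono) auto
    then have "real (card J) * q \<le> real (card J) * (lam / 2 * (3 * a))"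
      using qab by (intro mult_left_mono) auto
    with k(3) have "(k * a) * a \<le> (3 / 2 * lam * real (card J)) * a"
      by (simp add: power2_eq_square mult_ac)
    then have ka: "k * a \<le> 3 / 2 * lam * real (card J)" using k(5) by simp
    have "l1_norm u \<le> 4 * a"
      using l1_norm_split[of u J] ab by (simp add: a_def b_def)
    also have "\<dots> \<le> 6 * lam * real (card J) / k"
      using ka kpos by (simp add: pos_le_divide_eq mult_ac)
    finally have "(l1_norm u)\<^sup>2 \<le> (6 * lam * real (card J) / k)\<^sup>2"
      by (rule power_mono) simp
    then show ?thesis using False by (simp add: k(1) power2_eq_square)
  qed
qed

lemma restricted_eigenvalue_on_quadratic:
  assumes "psd A"
  shows "restricted_eigenvalue_on A J c =
     (INF v \<in> {v. l1_norm (restrict_vec (- J) v) \<le> c * l1_norm (restrict_vec J v)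
                  \<and> norm (restrict_vec J v) = 1}. ereal (v \<bullet> (A *v v)))"
  by (simp add: restricted_eigenvalue_on_def norm_psd_sqrt[OF assms])

lemma restricted_eigenvalue_nonneg:
  fixes A :: "real^'n^'n"
  shows "0 \<le> restricted_eigenvalue A s c"
proof -
  have "0 \<le> restricted_eigenvalue_on A J c" for J
    unfolding restricted_eigenvalue_on_def by (intro INF_greatest) simp
  moreover have "({} :: 'n set) \<in> {J. card J \<le> s}" by simp
  ultimately show ?thesis
    unfolding restricted_eigenvalue_def by (intro Min.boundedI) (auto intro: exI[of _ "{}"])
qed

text \<open>
  The normalisation \<open>norm (restrict_vec J v) = 1\<close> in the definition is removed by scaling.
\<close>

lemma restricted_eigenvalue_le:
  assumes A: "psd A" and "card J \<le> s"
    and "l1_norm (restrict_vec (- J) v) \<le> c * l1_norm (restrict_vec J v)"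
    and nz: "restrict_vec J v \<noteq> 0"
  shows "restricted_eigenvalue A s c \<le> ereal (v \<bullet> (A *v v) / (norm (restrict_vec J v))\<^sup>2)"
proof -
  define r where "r = norm (restrict_vec J v)"
  define w where "w = (1 / r) *\<^sub>R v"
  have r: "0 < r" using nz by (simp add: r_def)
  have "restricted_eigenvalue A s c \<le> restricted_eigenvalue_on A J c"
    unfolding restricted_eigenvalue_def using assms(2) by (intro Min_le) auto
  also have "\<dots> \<le> ereal (w \<bullet> (A *v w))"
    unfolding restricted_eigenvalue_on_quadratic[OF A]
  proof (rule INF_lower, clarify, rule conjI)
    show "l1_norm (restrict_vec (- J) w) \<le> c * l1_norm (restrict_vec J w)"
      using assms(3) r
      by (simp add: w_def restrict_vec_scaleR l1_norm_scaleR divide_right_mono)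
    show "norm (restrict_vec J w) = 1"
      using r by (simp add: w_def restrict_vec_scaleR r_def[symmetric])
  qed
  also have "w \<bullet> (A *v w) = v \<bullet> (A *v v) / r\<^sup>2"
    by (simp add: w_def matrix_vector_mult_scaleR power2_eq_square)
  finally show ?thesis by (simp add: r_def)
qed

text \<open>
  A set of \<open>s\<close> coordinates with maximal l1-norm: exchanging one of its elements for an outside
  coordinate cannot increase the norm, so every outside coordinate is dominated in absolute value by
  every inside one.
\<close>

lemma obtain_largest_coordinates:
  fixes u :: "real^'n"
  assumes "s \<le> CARD('n)"
  obtains J where "card J = s" "\<And>K. card K = s \<Longrightarrow> l1_norm (restrict_vec K u) \<le> l1_norm (restrict_vec J u)"
    "\<And>j. j \<notin> J \<Longrightarrow> real s * \<bar>u $ j\<bar> \<le> l1_norm (restrict_vec J u)"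
proof -
  let ?S = "{K :: 'n set. card K = s}"
  have "?S \<noteq> {}" using obtain_subset_with_card_n[OF assms] by blast
  then have "Max ((\<lambda>K. l1_norm (restrict_vec K u)) ` ?S) \<in> (\<lambda>K. l1_norm (restrict_vec K u)) ` ?S"
    by (intro Max_in) auto
  then obtain J where J: "J \<in> ?S"
    and eq: "Max ((\<lambda>K. l1_norm (restrict_vec K u)) ` ?S) = l1_norm (restrict_vec J u)"
    by blast
  have max: "l1_norm (restrict_vec K u) \<le> l1_norm (restrict_vec J u)" if "K \<in> ?S" for K
    unfolding eq[symmetric] using that by (intro Max_ge) auto
  have "real s * \<bar>u $ j\<bar> \<le> l1_norm (restrict_vec J u)" if j: "j \<notin> J" for j
  proof -
    have "\<bar>u $ j\<bar> \<le> \<bar>u $ i\<bar>" if i: "i \<in> J" for i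
    proof -
      let ?K = "insert j (J - {i})"
      have "card ?K = s"
        using J i j card_Suc_Diff1[of J i] by simp
      then have "l1_norm (restrict_vec ?K u) \<le> l1_norm (restrict_vec J u)" using max by blast
      then show ?thesis
        using i j by (simp add: l1_norm_restrict sum.remove[of J i])
    qed
    then have "(\<Sum>i\<in>J. \<bar>u $ j\<bar>) \<le> (\<Sum>i\<in>J. \<bar>u $ i\<bar>)" by (intro sum_mono)
    then show ?thesis using J by (simp add: l1_norm_restrict)
  qed
  moreover have "card J = s" using J by simp
  ultimately show ?thesis using max by (intro that[of J]) simp_all
qed

text \<open>
  Let \<open>K\<close> hold the \<open>|J|\<close> largest coordinates of \<open>u\<close>. Passing from \<open>J\<close> to \<open>K\<close> keeps the cone condition,
  and the restricted eigenvalue on \<open>K\<close> bounds \<open>r = |u_K|\<^sub>2\<close> by \<open>3/2 lam sqrt |J| / k\<close>. Coordinates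
  outside \<open>K\<close> are in absolute value at most the average over \<open>K\<close>, so their squared l2-norm is at most
  \<open>|u_K|\<^sub>1 |u_Kc|\<^sub>1 / |J| \<le> 3 r\<^sup>2\<close>. Altogether \<open>|u|\<^sub>2\<^sup>2 \<le> 4 r\<^sup>2\<close>.
\<close>

lemma l2_error_le_restricted_eigenvalue:
  fixes A :: "real^'n^'n"
  assumes A: "psd A" and lam: "0 < lam" and c: "0 < c"
    and cone: "u \<bullet> (A *v u) < lam / 2 * (3 * l1_norm (restrict_vec J u) - l1_norm (restrict_vec (- J) u))"
  shows "ereal (c * (norm u)\<^sup>2)
    \<le> ereal (9 * c * lam\<^sup>2 * real (card J)) / (restricted_eigenvalue A (card J) 3)\<^sup>2"
proof -
  define a where "a = l1_norm (restrict_vec J u)"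
  define b where "b = l1_norm (restrict_vec (- J) u)"
  define q where "q = u \<bullet> (A *v u)"
  define s where "s = card J"
  have q: "0 \<le> q" using A by (simp add: q_def psd_nonneg)
  have qab: "q < lam / 2 * (3 * a - b)" using cone by (simp add: q_def a_def b_def)
  with q have "0 < lam / 2 * (3 * a - b)" by linarith
  with lam have ab: "b < 3 * a" by (simp add: zero_less_mult_iff)
  have b: "0 \<le> b" by (simp add: b_def)
  with ab have a: "0 < a" by simp
  then have "J \<noteq> {}" by (auto simp: a_def l1_norm_restrict)
  then have s: "0 < s" by (simp add: s_def card_gt_0_iff)
  have "s \<le> CARD('n)" unfolding s_def by (intro card_mono) auto
  then obtain K where K: "card K = s"
    and max: "\<And>L. card L = s \<Longrightarrow> l1_norm (restrict_vec L u) \<le> l1_norm (restrict_vec K u)"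
    and tail: "\<And>j. j \<notin> K \<Longrightarrow> real s * \<bar>u $ j\<bar> \<le> l1_norm (restrict_vec K u)"
    using obtain_largest_coordinates[of s u] by metis
  define a0 where "a0 = l1_norm (restrict_vec K u)"
  define b0 where "b0 = l1_norm (restrict_vec (- K) u)"
  define r where "r = norm (restrict_vec K u)"
  have aa0: "a \<le> a0" using max[of J] by (simp add: a_def a0_def s_def)
  have "a + b = a0 + b0"
    using l1_norm_split[of u J] l1_norm_split[of u K] by (simp add: a_def b_def a0_def b0_def)
  with aa0 ab have b0: "b0 \<le> 3 * a0" by simp
  have a0r: "a0 \<le> sqrt (real s) * r"
    using l1_norm_restrict_le[of K u] by (simp add: a0_def r_def K)
  have "l1_norm (restrict_vec K u) \<noteq> 0" using a aa0 by (simp add: a0_def[symmetric])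
  then have nz: "restrict_vec K u \<noteq> 0" by simp
  then have r: "0 < r" by (simp add: r_def)
  have le: "restricted_eigenvalue A s 3 \<le> ereal (q / r\<^sup>2)"
    unfolding q_def r_def using b0 K nz by (intro restricted_eigenvalue_le[OF A]) (auto simp: a0_def b0_def)
  moreover have "0 \<le> restricted_eigenvalue A s 3" by (rule restricted_eigenvalue_nonneg)
  ultimately obtain k where k: "restricted_eigenvalue A s 3 = ereal k" "0 \<le> k"
    by (cases "restricted_eigenvalue A s 3") auto
  show ?thesis
  proof (cases "k = 0")
    case True
    then show ?thesis using lam s c by (simp add: k(1) s_def[symmetric] power2_eq_square)
  next
    case False
    then have kpos: "0 < k" using k(2) by simp
    have "k * r\<^sup>2 \<le> q" using le r by (simp add: k pos_le_divide_eq)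
    also have "q \<le> lam / 2 * (3 * a - b)" using qab by simp
    also have "\<dots> \<le> lam / 2 * (3 * a)" using lam b by (intro mult_left_mono) auto
    also have "\<dots> \<le> lam / 2 * (3 * (sqrt (real s) * r))"
      using lam aa0 a0r by (intro mult_left_mono) auto
    finally have "(k * r) * r \<le> (3 / 2 * lam * sqrt (real s)) * r"
      by (simp add: power2_eq_square mult_ac)
    then have "k * r \<le> 3 / 2 * lam * sqrt (real s)" using r by simp
    then have "(k * r)\<^sup>2 \<le> (3 / 2 * lam * sqrt (real s))\<^sup>2"
      using k(2) r by (intro power_mono) auto
    also have "\<dots> = 9 / 4 * (lam\<^sup>2 * real s)"
      by (simp add: power_mult_distrib power_divide)
    finally have kr: "4 * (k\<^sup>2 * r\<^sup>2) \<le> 9 * lam\<^sup>2 * real s"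
      by (simp add: power_mult_distrib)
    have "real s * (norm (restrict_vec (- K) u))\<^sup>2 = (\<Sum>j\<in>-K. (real s * \<bar>u $ j\<bar>) * \<bar>u $ j\<bar>)"
      unfolding norm_restrict_squared sum_distrib_left
      by (intro sum.cong) (simp_all add: power2_eq_square mult.assoc)
    also have "\<dots> \<le> (\<Sum>j\<in>-K. a0 * \<bar>u $ j\<bar>)"
      using tail by (intro sum_mono mult_right_mono) (auto simp: a0_def)
    also have "\<dots> = a0 * b0" by (simp add: b0_def l1_norm_restrict sum_distrib_left)
    also have "\<dots> \<le> a0 * (3 * a0)" using b0 a aa0 by (intro mult_left_mono) auto
    also have "\<dots> \<le> 3 * (sqrt (real s) * r)\<^sup>2"
      using power_mono[OF a0r, of 2] a aa0 by (simp add: power2_eq_square)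
    also have "\<dots> = real s * (3 * r\<^sup>2)" by (simp add: power_mult_distrib)
    finally have "(norm (restrict_vec (- K) u))\<^sup>2 \<le> 3 * r\<^sup>2" using s by simp
    then have "(norm u)\<^sup>2 \<le> 4 * r\<^sup>2"
      using norm_squared_split[of u K] by (simp add: r_def)
    then have "k\<^sup>2 * (norm u)\<^sup>2 \<le> k\<^sup>2 * (4 * r\<^sup>2)" by (intro mult_left_mono) auto
    also have "\<dots> \<le> 9 * lam\<^sup>2 * real s" using kr by (simp add: mult_ac)
    finally have "c * (k\<^sup>2 * (norm u)\<^sup>2) \<le> c * (9 * lam\<^sup>2 * real s)"
      using c by (intro mult_left_mono) auto
    then have "c * (norm u)\<^sup>2 \<le> 9 * c * lam\<^sup>2 * real s / k\<^sup>2"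
      using kpos by (simp add: pos_le_divide_eq mult_ac)
    then show ?thesis using False by (simp add: k(1) s_def[symmetric] power2_eq_square)
  qed
qed

text \<open>
  Let \<open>Q = u \<bullet> G u\<close>, let \<open>a\<close> and \<open>b\<close> be the l1-norms of \<open>u\<close> on and off \<open>J\<close>, and \<open>k\<close> the compatibility
  constant of \<open>G\<close>. Replacing \<open>A\<close> by \<open>G\<close> costs at most \<open>t (a + b)\<^sup>2\<close>, and \<open>16 |J| t \<le> k\<close> together with
  \<open>k a\<^sup>2 \<le> |J| Q\<close> bounds this by the fraction \<open>((a + b) / (4 a))\<^sup>2\<close> of \<open>Q\<close>. That fraction tends to 1 as \<open>b\<close>
  approaches \<open>3 a\<close>, but then the upper bound \<open>lam / 2 * (3 a - b)\<close> tends to 0 as well: since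
  \<open>16 a\<^sup>2 - (a + b)\<^sup>2 = (3 a - b) (5 a + b)\<close>, the vanishing factor cancels and \<open>Q \<le> 8/5 lam a\<close> remains.
  Combined once more with \<open>k a\<^sup>2 \<le> |J| Q\<close>, this yields the bound.
\<close>

lemma prediction_error_le_population_compatibility:
  fixes A G :: "real^'n^'n"
  assumes A: "psd A" and G: "psd G" and lam: "0 < lam"
    and cone: "u \<bullet> (A *v u) < lam / 2 * (3 * l1_norm (restrict_vec J u) - l1_norm (restrict_vec (- J) u))"
    and close: "\<And>j k. \<bar>A $ j $ k - G $ j $ k\<bar> \<le> t"
    and small: "ereal (16 * real (card J) * t) \<le> compatibility G J 3"
  shows "ereal (u \<bullet> (G *v u)) \<le> ereal (9 * lam\<^sup>2 * real (card J)) / compatibility G J 3"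
proof -
  define a where "a = l1_norm (restrict_vec J u)"
  define b where "b = l1_norm (restrict_vec (- J) u)"
  define q where "q = u \<bullet> (A *v u)"
  define Q where "Q = u \<bullet> (G *v u)"
  have q: "0 \<le> q" using A by (simp add: q_def psd_nonneg)
  have Q: "0 \<le> Q" using G by (simp add: Q_def psd_nonneg)
  have qab: "q < lam / 2 * (3 * a - b)" using cone by (simp add: q_def a_def b_def)
  with q have "0 < lam / 2 * (3 * a - b)" by linarith
  with lam have ab: "b < 3 * a" by (simp add: zero_less_mult_iff)
  have b: "0 \<le> b" by (simp add: b_def)
  obtain k where k: "compatibility G J 3 = ereal k" "0 \<le> k" "k * a\<^sup>2 \<le> real (card J) * Q"
    "0 < card J" "0 < a"
    using compatibility_cone_real[OF G, of J u] ab unfolding a_def b_def Q_def by blast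
  show ?thesis
  proof (cases "k = 0")
    case True
    then show ?thesis using lam k(4) by (auto simp: k(1) card_gt_0_iff)
  next
    case False
    then have kpos: "0 < k" using k(2) by simp
    have "u \<bullet> ((G - A) *v u) \<le> t * (l1_norm u)\<^sup>2"
      using close by (intro quadratic_form_le_l1) (simp add: abs_minus_commute)
    then have "Q \<le> q + t * (a + b)\<^sup>2"
      using l1_norm_split[of u J]
      by (simp add: Q_def q_def a_def b_def matrix_vector_mult_diff_rdistrib inner_diff_right)
    with qab have Qle: "Q \<le> lam / 2 * (3 * a - b) + t * (a + b)\<^sup>2" by simp
    have "real (card J) * (16 * t * a\<^sup>2) \<le> k * a\<^sup>2"
      using small mult_right_mono[of "16 * real (card J) * t" k "a\<^sup>2"] by (simp add: k(1) mult_ac)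
    with k(3) have "real (card J) * (16 * t * a\<^sup>2) \<le> real (card J) * Q" by linarith
    then have t: "16 * t * a\<^sup>2 \<le> Q" using k(4) by simp
    have "16 * a\<^sup>2 * Q \<le> 16 * a\<^sup>2 * (lam / 2 * (3 * a - b) + t * (a + b)\<^sup>2)"
      using Qle by (intro mult_left_mono) auto
    also have "\<dots> = 8 * a\<^sup>2 * lam * (3 * a - b) + (16 * t * a\<^sup>2) * (a + b)\<^sup>2"
      by (simp add: algebra_simps)
    also have "\<dots> \<le> 8 * a\<^sup>2 * lam * (3 * a - b) + Q * (a + b)\<^sup>2"
      using t by (intro add_left_mono mult_right_mono) auto
    finally have "(3 * a - b) * (Q * (5 * a + b)) \<le> (3 * a - b) * (8 * a\<^sup>2 * lam)"
      by (simp add: algebra_simps power2_eq_square)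
    then have "Q * (5 * a + b) \<le> 8 * a\<^sup>2 * lam" using ab by simp
    moreover have "Q * (5 * a) \<le> Q * (5 * a + b)" using Q b by (intro mult_left_mono) auto
    ultimately have "(5 * Q) * a \<le> (8 * a * lam) * a" by (simp add: power2_eq_square mult_ac)
    then have "5 * Q \<le> 8 * (a * lam)" using k(5) by (simp add: mult_ac)
    moreover have "0 < a * lam" using k(5) lam by simp
    ultimately have Qa: "Q \<le> 3 * a * lam" by linarith
    have "k * Q\<^sup>2 \<le> k * (3 * a * lam)\<^sup>2"
      using Qa Q k(2) by (intro mult_left_mono power_mono) auto
    also have "\<dots> = 9 * lam\<^sup>2 * (k * a\<^sup>2)" by (simp add: power_mult_distrib)
    also have "\<dots> \<le> 9 * lam\<^sup>2 * (real (card J) * Q)"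
      using k(3) by (intro mult_left_mono) auto
    finally have kQ: "(k * Q) * Q \<le> (9 * lam\<^sup>2 * real (card J)) * Q"
      by (simp add: power2_eq_square mult_ac)
    have "k * Q \<le> 9 * lam\<^sup>2 * real (card J)"
    proof (cases "Q = 0")
      case False
      then show ?thesis using kQ Q by simp
    qed simp
    then have "Q \<le> 9 * lam\<^sup>2 * real (card J) / k"
      using kpos by (simp add: pos_le_divide_eq mult.commute)
    then show ?thesis using False by (simp add: k(1) Q_def[symmetric])
  qed
qed

section \<open>Concentration of sums of independent bounded variables\<close>

text \<open>
  Compare the exponential series from the quadratic term on with a geometric series of
  ratio \<open>c / 3\<close>, using \<open>fact (n + 2) \<ge> 2 * 3 ^ n\<close>.
\<close>

lemma exp_le_quadratic_subgamma:
  fixes y c :: real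
  assumes "\<bar>y\<bar> \<le> c" and "c < 3"
  shows "exp y \<le> 1 + y + y\<^sup>2 / (2 * (1 - c / 3))"
proof -
  have fact_ge: "2 * 3 ^ n \<le> (fact (n + 2) :: real)" for n
  proof (induction n)
    case (Suc n)
    have "2 * 3 ^ Suc n \<le> (3 :: real) * fact (n + 2)"
      unfolding power_Suc using Suc by linarith
    also have "\<dots> \<le> real (n + 3) * fact (n + 2)" by (intro mult_right_mono) auto
    also have "\<dots> = fact (Suc n + 2)" by (simp add: algebra_simps)
    finally show ?case .
  qed (simp add: numeral_2_eq_2)
  have c0: "0 \<le> c" using assms(1) by linarith
  have term_le: "inverse (fact (n + 2)) *\<^sub>R y ^ (n + 2) \<le> y\<^sup>2 / 2 * (c / 3) ^ n" for n
  proof -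
    have "y ^ (n + 2) \<le> \<bar>y\<bar> ^ (n + 2)" by (metis abs_ge_self power_abs)
    then have "y ^ (n + 2) / fact (n + 2) \<le> \<bar>y\<bar> ^ (n + 2) / fact (n + 2)"
      by (rule divide_right_mono) simp
    then have "inverse (fact (n + 2)) *\<^sub>R y ^ (n + 2) \<le> \<bar>y\<bar> ^ (n + 2) / fact (n + 2)"
      by (simp only: divide_inverse mult.commute real_scaleR_def)
    also have "\<dots> \<le> \<bar>y\<bar> ^ (n + 2) / (2 * 3 ^ n)"
      using fact_ge[of n] by (intro divide_left_mono) auto
    also have "\<dots> = y\<^sup>2 / 2 * (\<bar>y\<bar> / 3) ^ n"
      by (simp add: power_divide power2_eq_square)
    also have "\<dots> \<le> y\<^sup>2 / 2 * (c / 3) ^ n"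
      using assms(1) by (intro mult_left_mono power_mono) auto
    finally show ?thesis .
  qed
  have geo: "(\<lambda>n. y\<^sup>2 / 2 * (c / 3) ^ n) sums (y\<^sup>2 / 2 * (1 / (1 - c / 3)))"
    using assms(2) c0 by (intro sums_mult geometric_sums) simp
  have "summable (\<lambda>n. inverse (fact (n + 2)) *\<^sub>R y ^ (n + 2))"
    using summable_ignore_initial_segment[OF summable_exp_generic[of y], of 2] by simp
  then have "(\<Sum>n. inverse (fact (n + 2)) *\<^sub>R y ^ (n + 2)) \<le> y\<^sup>2 / 2 * (1 / (1 - c / 3))"
    using sums_unique[OF geo] suminf_le[OF term_le _ sums_summable[OF geo]] by simp
  then show ?thesis unfolding exp_first_two_terms[of y] by simp
qed

text \<open>
  The exponent contains raw first and second moments of \<open>W\<close>, so the bound can be applied to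
  uncentred variables whose means cancel only in the sum; centring each one could double \<open>b\<close>.
\<close>

lemma (in prob_space) nn_integral_exp_le_bernstein:
  fixes W :: "'a \<Rightarrow> real"
  assumes [measurable]: "W \<in> borel_measurable M"
    and bound: "AE \<omega> in M. \<bar>W \<omega>\<bar> \<le> b" and "0 \<le> \<theta>" and "\<theta> * b < 3"
  shows "(\<integral>\<^sup>+\<omega>. ennreal (exp (\<theta> * W \<omega>)) \<partial>M)
    \<le> ennreal (exp (\<theta> * expectation W + \<theta>\<^sup>2 / (2 * (1 - \<theta> * b / 3)) * expectation (\<lambda>\<omega>. (W \<omega>)\<^sup>2)))"
proof -
  define g where "g = \<theta>\<^sup>2 / (2 * (1 - \<theta> * b / 3))"
  define h where "h = (\<lambda>\<omega>. 1 + \<theta> * W \<omega> + g * (W \<omega>)\<^sup>2)"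
  have intW: "integrable M W"
    using bound by (intro integrable_const_bound[of _ b]) auto
  have "AE \<omega> in M. norm ((W \<omega>)\<^sup>2) \<le> b\<^sup>2"
    using bound
  proof eventually_elim
    case (elim \<omega>)
    then have "\<bar>W \<omega>\<bar> \<le> \<bar>b\<bar>" by linarith
    then show ?case by (simp add: abs_le_square_iff)
  qed
  then have intW2: "integrable M (\<lambda>\<omega>. (W \<omega>)\<^sup>2)"
    by (intro integrable_const_bound[of _ "b\<^sup>2"]) auto
  have exp_le: "AE \<omega> in M. exp (\<theta> * W \<omega>) \<le> h \<omega>"
    using bound
  proof eventually_elim
    case (elim \<omega>)
    have "\<bar>\<theta> * W \<omega>\<bar> \<le> \<theta> * b"
      using elim \<open>0 \<le> \<theta>\<close> by (simp add: abs_mult mult_left_mono)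
    from exp_le_quadratic_subgamma[OF this \<open>\<theta> * b < 3\<close>] show ?case
      by (simp add: h_def g_def power_mult_distrib)
  qed
  have "(\<integral>\<^sup>+\<omega>. ennreal (exp (\<theta> * W \<omega>)) \<partial>M) \<le> (\<integral>\<^sup>+\<omega>. ennreal (h \<omega>) \<partial>M)"
    using exp_le by (intro nn_integral_mono_AE) (auto elim!: eventually_mono intro: ennreal_leI)
  also have "\<dots> = ennreal (expectation h)"
  proof (rule nn_integral_eq_integral)
    show "integrable M h" unfolding h_def using intW intW2 by simp
    show "AE \<omega> in M. 0 \<le> h \<omega>"
      using exp_le by eventually_elim (rule order_trans[OF exp_ge_zero])
  qed
  also have "expectation h = 1 + (\<theta> * expectation W + g * expectation (\<lambda>\<omega>. (W \<omega>)\<^sup>2))"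
    unfolding h_def using intW intW2 by (simp add: prob_space)
  also have "ennreal \<dots> \<le> ennreal (exp (\<theta> * expectation W + g * expectation (\<lambda>\<omega>. (W \<omega>)\<^sup>2)))"
    by (intro ennreal_leI exp_ge_add_one_self)
  finally show ?thesis by (simp only: g_def)
qed

text \<open>
  The Chernoff method. The threshold is the exact inverse of the sub-gamma rate function, which has a
  linear term \<open>b * L / 3\<close>; inverting the weaker bound \<open>exp (- t\<^sup>2 / (2 * (v + b * t / 3)))\<close> would
  about double that term for large \<open>L\<close>.
\<close>

theorem (in prob_space) Bernstein_ineq_ge:
  fixes W :: "'i \<Rightarrow> 'a \<Rightarrow> real"
  assumes fin: "finite I" and indep: "indep_vars (\<lambda>_. borel) W I"
    and bound: "\<And>i. i \<in> I \<Longrightarrow> AE \<omega> in M. \<bar>W i \<omega>\<bar> \<le> b" and "0 \<le> b"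
    and mean: "(\<Sum>i\<in>I. expectation (W i)) = 0"
    and var: "(\<Sum>i\<in>I. expectation (\<lambda>\<omega>. (W i \<omega>)\<^sup>2)) \<le> v" and "0 < v"
    and "0 < L" and t: "sqrt (2 * v * L) + b * L / 3 \<le> t"
  shows "prob {\<omega> \<in> space M. t \<le> (\<Sum>i\<in>I. W i \<omega>)} \<le> exp (- L)"
proof -
  have [measurable]: "W i \<in> borel_measurable M" if "i \<in> I" for i
    using indep that by (auto simp: indep_vars_def)
  define r where "r = sqrt (2 * L / v)"
  define c where "c = b / 3"
  \<comment> \<open>The minimiser of \<open>- \<theta> t + v \<theta>\<^sup>2 / (2 (1 - c \<theta>))\<close> for \<open>t = sqrt (2 v L) + c L\<close>;
    the minimum is exactly \<open>- L\<close>.\<close>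
  define \<theta> where "\<theta> = r / (1 + c * r)"
  define g where "g = \<theta>\<^sup>2 / (2 * (1 - \<theta> * b / 3))"
  have r: "0 < r" using \<open>0 < L\<close> \<open>0 < v\<close> by (simp add: r_def)
  have c: "0 \<le> c" using \<open>0 \<le> b\<close> by (simp add: c_def)
  have cr: "0 < 1 + c * r" using r c by (simp add: add_pos_nonneg)
  have \<theta>: "0 < \<theta>" using r cr by (simp add: \<theta>_def)
  have vr2: "v * r\<^sup>2 = 2 * L" using \<open>0 < L\<close> \<open>0 < v\<close> by (simp add: r_def)
  have vr: "sqrt (2 * v * L) = v * r"
    by (rule real_sqrt_unique) (use vr2 r \<open>0 < v\<close> in \<open>simp_all add: power2_eq_square mult_ac\<close>)
  have one_minus: "1 - \<theta> * b / 3 = 1 / (1 + c * r)"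
    using cr by (simp add: \<theta>_def c_def field_simps)
  moreover have "0 < 1 / (1 + c * r)" using cr by simp
  ultimately have \<theta>b: "\<theta> * b < 3" by linarith
  have g0: "0 \<le> g" unfolding g_def one_minus using cr by simp
  have gv: "g * v = L / (1 + c * r)"
  proof -
    have "g = \<theta>\<^sup>2 * (1 + c * r) / 2" unfolding g_def one_minus by simp
    also have "\<dots> = r\<^sup>2 / (2 * (1 + c * r))"
      using cr by (simp add: \<theta>_def power2_eq_square)
    finally have "g * v = (v * r\<^sup>2) / (2 * (1 + c * r))" by simp
    then show ?thesis unfolding vr2 by (simp only: mult_divide_mult_cancel_left_if) simp
  qed
  have \<theta>t: "L + L / (1 + c * r) \<le> \<theta> * t"
  proof -
    have "L + L / (1 + c * r) = (v * r\<^sup>2 + c * r * L) / (1 + c * r)"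
      unfolding vr2 using cr by (simp add: field_simps)
    also have "\<dots> = \<theta> * (v * r + c * L)"
      by (simp add: \<theta>_def power2_eq_square algebra_simps)
    also have "\<dots> \<le> \<theta> * t" using t \<theta> by (intro mult_left_mono) (auto simp: vr c_def)
    finally show ?thesis .
  qed
  have "ennreal (prob {\<omega>\<in>space M. t \<le> (\<Sum>i\<in>I. W i \<omega>)}) = emeasure M {\<omega>\<in>space M. t \<le> (\<Sum>i\<in>I. W i \<omega>)}"
    by (simp add: emeasure_eq_measure)
  also have "\<dots> \<le> ennreal (exp (- \<theta> * t)) * (\<integral>\<^sup>+\<omega>\<in>space M. ennreal (exp (\<theta> * (\<Sum>i\<in>I. W i \<omega>))) \<partial>M)"
    by (intro Chernoff_ineq_nn_integral_ge \<theta>) auto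
  also have "(\<integral>\<^sup>+\<omega>\<in>space M. ennreal (exp (\<theta> * (\<Sum>i\<in>I. W i \<omega>))) \<partial>M)
      = (\<integral>\<^sup>+\<omega>. (\<Prod>i\<in>I. ennreal (exp (\<theta> * W i \<omega>))) \<partial>M)"
    by (intro nn_integral_cong) (simp add: sum_distrib_left exp_sum fin prod_ennreal)
  also have "\<dots> = (\<Prod>i\<in>I. \<integral>\<^sup>+\<omega>. ennreal (exp (\<theta> * W i \<omega>)) \<partial>M)"
    by (intro indep_vars_nn_integral fin indep_vars_compose2[OF indep]) auto
  also have "\<dots> \<le> (\<Prod>i\<in>I. ennreal (exp (\<theta> * expectation (W i) + g * expectation (\<lambda>\<omega>. (W i \<omega>)\<^sup>2))))"
    unfolding g_def using bound \<theta> \<theta>b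
    by (intro prod_mono_ennreal nn_integral_exp_le_bernstein) auto
  also have "\<dots> = ennreal (exp (\<Sum>i\<in>I. \<theta> * expectation (W i) + g * expectation (\<lambda>\<omega>. (W i \<omega>)\<^sup>2)))"
    by (simp add: prod_ennreal exp_sum fin)
  also have "(\<Sum>i\<in>I. \<theta> * expectation (W i) + g * expectation (\<lambda>\<omega>. (W i \<omega>)\<^sup>2))
      = g * (\<Sum>i\<in>I. expectation (\<lambda>\<omega>. (W i \<omega>)\<^sup>2))"
    using mean by (simp add: sum.distrib sum_distrib_left[symmetric])
  finally have "ennreal (prob {\<omega>\<in>space M. t \<le> (\<Sum>i\<in>I. W i \<omega>)})
      \<le> ennreal (exp (- \<theta> * t)) * ennreal (exp (g * (\<Sum>i\<in>I. expectation (\<lambda>\<omega>. (W i \<omega>)\<^sup>2))))"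
    by (simp add: mult_left_mono)
  also have "\<dots> = ennreal (exp (- \<theta> * t + g * (\<Sum>i\<in>I. expectation (\<lambda>\<omega>. (W i \<omega>)\<^sup>2))))"
    by (subst ennreal_mult[symmetric]) (simp_all add: exp_add[symmetric])
  finally have "prob {\<omega>\<in>space M. t \<le> (\<Sum>i\<in>I. W i \<omega>)}
      \<le> exp (- \<theta> * t + g * (\<Sum>i\<in>I. expectation (\<lambda>\<omega>. (W i \<omega>)\<^sup>2)))"
    by (subst (asm) ennreal_le_iff) auto
  also have "\<dots> \<le> exp (- L)"
  proof (subst exp_le_cancel_iff)
    have "g * (\<Sum>i\<in>I. expectation (\<lambda>\<omega>. (W i \<omega>)\<^sup>2)) \<le> g * v"
      using var g0 by (rule mult_left_mono)
    then show "- \<theta> * t + g * (\<Sum>i\<in>I. expectation (\<lambda>\<omega>. (W i \<omega>)\<^sup>2)) \<le> - L"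
      using gv \<theta>t by simp
  qed
  finally show ?thesis .
qed

corollary (in prob_space) Bernstein_ineq_abs_ge:
  fixes W :: "'i \<Rightarrow> 'a \<Rightarrow> real"
  assumes fin: "finite I" and indep: "indep_vars (\<lambda>_. borel) W I"
    and bound: "\<And>i. i \<in> I \<Longrightarrow> AE \<omega> in M. \<bar>W i \<omega>\<bar> \<le> b" and "0 \<le> b"
    and mean: "(\<Sum>i\<in>I. expectation (W i)) = 0"
    and var: "(\<Sum>i\<in>I. expectation (\<lambda>\<omega>. (W i \<omega>)\<^sup>2)) \<le> v" and "0 < v"
    and "0 < L" and t: "sqrt (2 * v * L) + b * L / 3 \<le> t"
  shows "prob {\<omega> \<in> space M. t \<le> \<bar>\<Sum>i\<in>I. W i \<omega>\<bar>} \<le> 2 * exp (- L)"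
proof -
  have [measurable]: "W i \<in> borel_measurable M" if "i \<in> I" for i
    using indep that by (auto simp: indep_vars_def)
  have "{\<omega> \<in> space M. t \<le> \<bar>\<Sum>i\<in>I. W i \<omega>\<bar>}
      = {\<omega> \<in> space M. t \<le> (\<Sum>i\<in>I. W i \<omega>)} \<union> {\<omega> \<in> space M. t \<le> (\<Sum>i\<in>I. - W i \<omega>)}"
    by (auto simp: sum_negf)
  also have "prob \<dots> \<le> prob {\<omega> \<in> space M. t \<le> (\<Sum>i\<in>I. W i \<omega>)}
      + prob {\<omega> \<in> space M. t \<le> (\<Sum>i\<in>I. - W i \<omega>)}"
    by (intro measure_Un_le) auto
  also have "\<dots> \<le> exp (- L) + exp (- L)"
  proof (rule add_mono)
    show "prob {\<omega> \<in> space M. t \<le> (\<Sum>i\<in>I. W i \<omega>)} \<le> exp (- L)"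
      by (rule Bernstein_ineq_ge) (use assms in auto)
    have "indep_vars (\<lambda>_. borel) (\<lambda>i \<omega>. - W i \<omega>) I"
      by (rule indep_vars_compose2[OF indep]) simp
    then show "prob {\<omega> \<in> space M. t \<le> (\<Sum>i\<in>I. - W i \<omega>)} \<le> exp (- L)"
      by (rule Bernstein_ineq_ge[OF fin]) (use assms in \<open>auto simp: sum_negf\<close>)
  qed
  finally show ?thesis by simp
qed

text \<open>
  An intersection of events of the merged family splits into one event from each block. The
  blocks are independent of each other, so its probability is a product of two factors, each of which
  factorises within its block.
\<close>

lemma (in prob_space) indep_vars_union_of_blocks:
  assumes fin: "finite I1" "finite I2" and disj: "I1 \<inter> I2 = {}"
    and indep1: "indep_vars N1 Z I1" and indep2: "indep_vars N2 X I2"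
    and blocks: "indep_set
       (sets (vimage_algebra (space M) (\<lambda>\<omega>. \<lambda>i\<in>I1. Z i \<omega>) (\<Pi>\<^sub>M i\<in>I1. N1 i)))
       (sets (vimage_algebra (space M) (\<lambda>\<omega>. \<lambda>i\<in>I2. X i \<omega>) (\<Pi>\<^sub>M i\<in>I2. N2 i)))"
    and g: "\<And>i. i \<in> I1 \<Longrightarrow> g i \<in> measurable (N1 i) K"
    and h: "\<And>i. i \<in> I2 \<Longrightarrow> h i \<in> measurable (N2 i) K"
  shows "indep_vars (\<lambda>_. K) (\<lambda>i \<omega>. if i \<in> I1 then g i (Z i \<omega>) else h i (X i \<omega>)) (I1 \<union> I2)"
proof -
  define W where "W = (\<lambda>i \<omega>. if i \<in> I1 then g i (Z i \<omega>) else h i (X i \<omega>))"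
  have gZ: "indep_vars (\<lambda>_. K) (\<lambda>i \<omega>. g i (Z i \<omega>)) I1"
    using indep1 g by (rule indep_vars_compose2)
  have hX: "indep_vars (\<lambda>_. K) (\<lambda>i \<omega>. h i (X i \<omega>)) I2"
    using indep2 h by (rule indep_vars_compose2)
  have W1: "indep_vars (\<lambda>_. K) W I1"
    by (rule indep_vars_cong[THEN iffD1, OF refl _ refl gZ]) (simp add: W_def)
  have W2: "indep_vars (\<lambda>_. K) W I2"
    by (rule indep_vars_cong[THEN iffD1, OF refl _ refl hX]) (use disj in \<open>auto simp: W_def disjoint_iff fun_eq_iff\<close>)
  have rv: "random_variable K (W i)" if "i \<in> I1 \<union> I2" for i
    using W1 W2 that unfolding indep_vars_def by blast
  have rv1: "Z i \<in> measurable M (N1 i)" if "i \<in> I1" for i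
    using indep1 that unfolding indep_vars_def by blast
  have rv2: "X i \<in> measurable M (N2 i)" if "i \<in> I2" for i
    using indep2 that unfolding indep_vars_def by blast
  have block_event: "{\<omega> \<in> space M. \<forall>j\<in>J. W j \<omega> \<in> B j}
      \<in> sets (vimage_algebra (space M) (\<lambda>\<omega>. \<lambda>i\<in>I. V i \<omega>) (\<Pi>\<^sub>M i\<in>I. N i))"
    if J: "J \<subseteq> I" and fin: "finite I" and V: "\<And>i. i \<in> I \<Longrightarrow> V i \<in> measurable M (N i)"
      and f: "\<And>i. i \<in> I \<Longrightarrow> f i \<in> measurable (N i) K" and W: "\<And>i \<omega>. i \<in> I \<Longrightarrow> W i \<omega> = f i (V i \<omega>)"
      and B: "\<And>j. j \<in> J \<Longrightarrow> B j \<in> sets K"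
    for J I V N f B
  proof -
    let ?F = "\<lambda>\<omega>. \<lambda>i\<in>I. V i \<omega>"
    let ?D = "{x \<in> space (\<Pi>\<^sub>M i\<in>I. N i). \<forall>j\<in>J. f j (x j) \<in> B j}"
    have "?D \<in> sets (\<Pi>\<^sub>M i\<in>I. N i)"
    proof (rule sets.sets_Collect_finite_All)
      show "finite J" using J fin by (rule finite_subset)
      fix j assume j: "j \<in> J"
      have "(\<lambda>x. f j (x j)) \<in> measurable (\<Pi>\<^sub>M i\<in>I. N i) K"
        using j J f by (intro measurable_compose[OF measurable_component_singleton]) auto
      then show "{x \<in> space (\<Pi>\<^sub>M i\<in>I. N i). f j (x j) \<in> B j} \<in> sets (\<Pi>\<^sub>M i\<in>I. N i)"
        using B[OF j] by measurable
    qed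
    then have "?F -` ?D \<inter> space M \<in> sets (vimage_algebra (space M) ?F (\<Pi>\<^sub>M i\<in>I. N i))"
      by (rule in_vimage_algebra)
    also have "?F -` ?D \<inter> space M = {\<omega> \<in> space M. \<forall>j\<in>J. W j \<omega> \<in> B j}"
      using J V[THEN measurable_space] W by (auto simp: space_PiM PiE_iff subset_iff)
    finally show ?thesis .
  qed
  have block_prob: "prob {\<omega> \<in> space M. \<forall>j\<in>J. W j \<omega> \<in> B j} = (\<Prod>j\<in>J. prob (W j -` B j \<inter> space M))"
    if "indep_vars (\<lambda>_. K) W I" "J \<subseteq> I" "finite J" "\<And>j. j \<in> J \<Longrightarrow> B j \<in> sets K" for J I B
  proof (cases "J = {}")
    case True
    then show ?thesis by (simp add: prob_space)
  next
    case False
    then have "{\<omega> \<in> space M. \<forall>j\<in>J. W j \<omega> \<in> B j} = (\<Inter>j\<in>J. W j -` B j \<inter> space M)" by auto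
    then show ?thesis using indep_varsD[OF that(1) False that(3,2,4)] by simp
  qed
  have "indep_vars (\<lambda>_. K) W (I1 \<union> I2)"
    unfolding indep_vars_def2
  proof (intro conjI ballI rv indep_setsI)
    fix i assume "i \<in> I1 \<union> I2"
    then show "{W i -` A \<inter> space M | A. A \<in> sets K} \<subseteq> events"
      using rv measurable_sets by blast
  next
    fix A J assume J: "J \<noteq> {}" "J \<subseteq> I1 \<union> I2" "finite J"
      and A: "\<forall>j\<in>J. A j \<in> {W j -` B \<inter> space M | B. B \<in> sets K}"
    then obtain B where B: "\<And>j. j \<in> J \<Longrightarrow> A j = W j -` B j \<inter> space M" "\<And>j. j \<in> J \<Longrightarrow> B j \<in> sets K"
      by simp metis
    define J1 where "J1 = J \<inter> I1"
    define J2 where "J2 = J \<inter> I2"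
    have J12: "J = J1 \<union> J2" "J1 \<inter> J2 = {}" "finite J1" "finite J2"
      using J disj by (auto simp: J1_def J2_def)
    let ?E = "\<lambda>J. {\<omega> \<in> space M. \<forall>j\<in>J. W j \<omega> \<in> B j}"
    have "(\<Inter>j\<in>J. A j) = ?E J1 \<inter> ?E J2"
      using J(1) B(1) by (auto simp: J12(1))
    moreover have "prob (?E J1 \<inter> ?E J2) = prob (?E J1) * prob (?E J2)"
    proof (rule indep_setD[OF blocks])
      show "?E J1 \<in> sets (vimage_algebra (space M) (\<lambda>\<omega>. \<lambda>i\<in>I1. Z i \<omega>) (\<Pi>\<^sub>M i\<in>I1. N1 i))"
        by (rule block_event[of _ _ Z _ g]) (use rv1 g B(2) fin in \<open>auto simp: J1_def W_def\<close>)
      show "?E J2 \<in> sets (vimage_algebra (space M) (\<lambda>\<omega>. \<lambda>i\<in>I2. X i \<omega>) (\<Pi>\<^sub>M i\<in>I2. N2 i))"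
        by (rule block_event[of _ _ X _ h]) (use rv2 h B(2) fin disj in \<open>auto simp: J2_def W_def\<close>)
    qed
    moreover have "prob (?E J1) = (\<Prod>j\<in>J1. prob (W j -` B j \<inter> space M))"
      using J12 B(2) by (intro block_prob[OF W1]) (auto simp: J1_def)
    moreover have "prob (?E J2) = (\<Prod>j\<in>J2. prob (W j -` B j \<inter> space M))"
      using J12 B(2) by (intro block_prob[OF W2]) (auto simp: J2_def)
    ultimately have "prob (\<Inter>j\<in>J. A j) = (\<Prod>j\<in>J. prob (W j -` B j \<inter> space M))"
      using J12 by (simp add: prod.union_disjoint)
    then show "prob (\<Inter>j\<in>J. A j) = (\<Prod>j\<in>J. prob (A j))"
      using B(1) by simp
  qed
  then show ?thesis by (simp only: W_def)
qed

section \<open>The linear model at the population level\<close>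

lemma measurable_pair_coordinates:
  "(\<lambda>z :: (real^'n) \<times> real. fst z $ j) \<in> borel_measurable borel"
  "(snd :: (real^'n) \<times> real \<Rightarrow> real) \<in> borel_measurable borel"
  "(fst :: (real^'n) \<times> real \<Rightarrow> real^'n) \<in> borel_measurable borel"
  "(\<lambda>z :: (real^'n) \<times> real. fst z \<bullet> \<beta>) \<in> borel_measurable borel"
  by (intro borel_measurable_continuous_onI continuous_intros)+

lemma AE_mult_bounded:
  fixes f g :: "'a \<Rightarrow> real"
  assumes "AE z in M. \<bar>f z\<bar> \<le> c" and "AE z in M. \<bar>g z\<bar> \<le> d"
  shows "AE z in M. \<bar>f z * g z\<bar> \<le> c * d"
  using assms
proof eventually_elim
  case (elim z)
  have "0 \<le> c" using elim(1) by linarith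
  then show ?case using elim by (auto simp: abs_mult intro: mult_mono)
qed

lemma (in finite_measure) integrable_bounded:
  fixes f :: "'a \<Rightarrow> real"
  assumes "f \<in> borel_measurable M" and "AE z in M. \<bar>f z\<bar> \<le> c"
  shows "integrable M f"
  using assms by (intro integrable_const_bound[of f c]) auto

lemma (in prob_space) prob_ge_if_bad_event:
  assumes "S \<in> events" "F \<in> events" "prob F \<le> e" and "space M - F \<subseteq> S"
  shows "1 - e \<le> prob S"
proof -
  have "1 - e \<le> prob (space M - F)" using assms by (simp add: prob_compl)
  also have "\<dots> \<le> prob S" using assms by (intro finite_measure_mono)
  finally show ?thesis .
qed

locale bounded_linear_law = prob_space P
  for P :: "((real^'p) \<times> real) measure" +
  fixes fstar :: "real^'p \<Rightarrow> real" and \<beta>star :: "real^'p" and B\<^sub>Y B\<^sub>X :: real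
  assumes sets_P: "sets P = sets borel"
    and std: "standardized P"
    and bdd: "bounded_data P B\<^sub>Y B\<^sub>X"
    and regression: "regression_function P fstar"
    and well_spec: "AE x in marginal_X P. fstar x = x \<bullet> \<beta>star"
begin

lemma measurable_P_iff: "measurable P N = measurable borel N"
  using sets_P by (rule measurable_cong_sets) simp

lemma measurable_P [measurable]:
  "(\<lambda>z. fst z $ j) \<in> borel_measurable P"
  "snd \<in> borel_measurable P"
  "fst \<in> borel_measurable P"
  "(\<lambda>z. fst z \<bullet> \<beta>) \<in> borel_measurable P"
  unfolding measurable_P_iff by (rule measurable_pair_coordinates)+

lemma AE_Y_le: "AE z in P. \<bar>snd z\<bar> \<le> B\<^sub>Y"
  using bdd unfolding bounded_data_def by eventually_elim simp

lemma AE_X_le: "AE z in P. \<bar>fst z $ j\<bar> \<le> B\<^sub>X"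
  using bdd unfolding bounded_data_def by eventually_elim simp

lemma B\<^sub>Y_nonneg: "0 \<le> B\<^sub>Y"
proof -
  have "AE z in P. 0 \<le> B\<^sub>Y" using AE_Y_le by eventually_elim simp
  then show ?thesis by simp
qed

lemma B\<^sub>X_nonneg: "0 \<le> B\<^sub>X"
proof -
  have "AE z in P. 0 \<le> B\<^sub>X" using AE_X_le[of undefined] by eventually_elim simp
  then show ?thesis by simp
qed

lemma integrable_X_sq: "integrable P (\<lambda>z. (fst z $ j)\<^sup>2)"
  using std by (simp add: standardized_def)

lemma integral_X_sq: "(\<integral>z. (fst z $ j)\<^sup>2 \<partial>P) = 1"
  using std by (simp add: standardized_def)

text \<open>
  A covariate with second moment 1 cannot vanish almost surely.
\<close>

lemma B\<^sub>X_pos: "0 < B\<^sub>X"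
proof (rule ccontr)
  assume "\<not> 0 < B\<^sub>X"
  with B\<^sub>X_nonneg have "B\<^sub>X = 0" by simp
  have "AE z in P. (fst z $ j)\<^sup>2 = 0" for j
    using AE_X_le[of j] by eventually_elim (simp add: \<open>B\<^sub>X = 0\<close>)
  then have "(\<integral>z. (fst z $ j)\<^sup>2 \<partial>P) = 0" for j by (rule integral_eq_zero_AE)
  then show False using integral_X_sq by simp
qed

lemma AE_XX_le: "AE z in P. \<bar>fst z $ j * fst z $ k\<bar> \<le> B\<^sub>X\<^sup>2"
  using AE_X_le[of j] AE_X_le[of k]
proof eventually_elim
  case (elim z)
  then have "\<bar>fst z $ j\<bar> * \<bar>fst z $ k\<bar> \<le> B\<^sub>X * B\<^sub>X"
    using B\<^sub>X_nonneg by (intro mult_mono) auto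
  then show ?case by (simp add: abs_mult power2_eq_square)
qed

lemma integrable_XX: "integrable P (\<lambda>z. fst z $ j * fst z $ k)"
  using AE_XX_le by (intro integrable_const_bound[of _ "B\<^sub>X\<^sup>2"]) auto

lemma second_moment_nth: "second_moment P $ j $ k = (\<integral>z. fst z $ j * fst z $ k \<partial>P)"
proof -
  have "(\<lambda>x :: real^'p. x $ j * x $ k) \<in> borel_measurable borel" by measurable
  then show ?thesis
    unfolding second_moment_def marginal_X_def
    by (simp add: outer_def integral_distr)
qed

text \<open>
  Off-diagonal entries are dominated by the unit diagonal because \<open>2 |x y| \<le> x\<^sup>2 + y\<^sup>2\<close>.
\<close>

lemma abs_second_moment_le_1: "\<bar>second_moment P $ j $ k\<bar> \<le> 1"
proof -
  have "\<bar>second_moment P $ j $ k\<bar> \<le> (\<integral>z. \<bar>fst z $ j * fst z $ k\<bar> \<partial>P)"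
    unfolding second_moment_nth by (rule integral_abs_bound)
  also have "\<dots> \<le> (\<integral>z. ((fst z $ j)\<^sup>2 + (fst z $ k)\<^sup>2) / 2 \<partial>P)"
  proof (rule integral_mono)
    show "integrable P (\<lambda>z. \<bar>fst z $ j * fst z $ k\<bar>)"
      using integrable_XX by (rule integrable_abs)
    show "integrable P (\<lambda>z. ((fst z $ j)\<^sup>2 + (fst z $ k)\<^sup>2) / 2)"
      using integrable_X_sq by simp
    fix z :: "(real^'p) \<times> real"
    have "0 \<le> (\<bar>fst z $ j\<bar> - \<bar>fst z $ k\<bar>)\<^sup>2" by simp
    then show "\<bar>fst z $ j * fst z $ k\<bar> \<le> ((fst z $ j)\<^sup>2 + (fst z $ k)\<^sup>2) / 2"
      by (simp add: abs_mult power2_diff)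
  qed
  also have "\<dots> = 1" using integrable_X_sq integral_X_sq by simp
  finally show ?thesis .
qed

lemma second_moment_quadratic: "v \<bullet> (second_moment P *v v) = (\<integral>z. (fst z \<bullet> v)\<^sup>2 \<partial>P)"
proof -
  have "(fst z \<bullet> v)\<^sup>2 = (\<Sum>j\<in>UNIV. \<Sum>k\<in>UNIV. (fst z $ j * fst z $ k) * (v $ j * v $ k))"
    for z :: "(real^'p) \<times> real"
    by (simp add: inner_vec_def power2_eq_square sum_product mult_ac)
  then show ?thesis
    using integrable_XX
    by (simp add: quadratic_form_sum second_moment_nth Bochner_Integration.integral_sum)
qed

lemma psd_second_moment: "psd (second_moment P)"
  unfolding psd_def
proof (intro conjI allI)
  show "transpose (second_moment P) = second_moment P"
    by (simp add: transpose_def vec_eq_iff second_moment_nth mult.commute)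
qed (simp add: second_moment_quadratic)

lemma second_moment_axis: "axis j 1 \<bullet> (second_moment P *v axis j 1) = 1"
  using integral_X_sq by (simp add: second_moment_quadratic inner_axis)

lemma quadratic_le_spectral_norm:
  "v \<bullet> (second_moment P *v v) \<le> spectral_norm (second_moment P) * (norm v)\<^sup>2"
proof -
  have "bounded_linear (\<lambda>v. second_moment P *v v)"
    by (simp add: linear_conv_bounded_linear[symmetric])
  then have "norm (second_moment P *v v) \<le> spectral_norm (second_moment P) * norm v"
    unfolding spectral_norm_def by (rule onorm)
  then have "norm v * norm (second_moment P *v v) \<le> norm v * (spectral_norm (second_moment P) * norm v)"
    by (rule mult_left_mono) simp
  with norm_cauchy_schwarz[of v "second_moment P *v v"] show ?thesis
    by (simp add: power2_eq_square mult_ac)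
qed

lemma spectral_norm_pos: "0 < spectral_norm (second_moment P)"
  using quadratic_le_spectral_norm[of "axis undefined 1"] by (simp add: second_moment_axis)

lemma fstar_P: "AE z in P. fstar (fst z) = fst z \<bullet> \<beta>star"
proof -
  have "fst \<in> measurable P borel" by measurable
  from AE_distrD[OF this well_spec[unfolded marginal_X_def]] show ?thesis .
qed

lemma excess_risk_linear:
  "excess_risk P fstar (linear_predictor \<beta>) = (\<beta> - \<beta>star) \<bullet> (second_moment P *v (\<beta> - \<beta>star))"
proof -
  have [measurable]: "fstar \<in> borel_measurable borel"
    using regression by (simp add: regression_function_def)
  have "excess_risk P fstar (linear_predictor \<beta>) = (\<integral>z. (fst z \<bullet> \<beta> - fstar (fst z))\<^sup>2 \<partial>P)"
    unfolding excess_risk_def linear_predictor_def marginal_X_def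
    by (subst integral_distr) auto
  also have "\<dots> = (\<integral>z. (fst z \<bullet> (\<beta> - \<beta>star))\<^sup>2 \<partial>P)"
    using fstar_P by (intro integral_cong_AE) (auto simp: inner_diff_right)
  finally show ?thesis by (simp add: second_moment_quadratic)
qed

abbreviation "covariate_algebra \<equiv> vimage_algebra (space P) fst (borel :: (real^'p) measure)"

lemma subalgebra_covariates: "finite_measure_subalgebra P covariate_algebra"
proof
  show "subalgebra P covariate_algebra"
    unfolding subalgebra_def
    using sets_image_in_sets[of P "space P" fst borel] by auto
qed

lemma cond_exp_linear: "AE z in P. real_cond_exp P covariate_algebra snd z = fst z \<bullet> \<beta>star"
proof -
  have "AE z in P. real_cond_exp P covariate_algebra snd z = fstar (fst z)"
    using regression by (simp add: regression_function_def)
  then show ?thesis using fstar_P by eventually_elim simp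
qed

text \<open>
  The linear predictor is a conditional expectation of \<open>Y\<close> and inherits its bound.
\<close>

lemma AE_linear_le: "AE z in P. \<bar>fst z \<bullet> \<beta>star\<bar> \<le> B\<^sub>Y"
proof -
  interpret finite_measure_subalgebra P covariate_algebra by (rule subalgebra_covariates)
  have int: "integrable P snd" using std by (simp add: standardized_def)
  have "AE z in P. snd z \<le> B\<^sub>Y" using AE_Y_le by eventually_elim simp
  then have up: "AE z in P. real_cond_exp P covariate_algebra snd z \<le> B\<^sub>Y"
    by (rule real_cond_exp_le_c[OF int])
  have "AE z in P. - B\<^sub>Y \<le> snd z" using AE_Y_le by eventually_elim simp
  then have "AE z in P. - B\<^sub>Y \<le> real_cond_exp P covariate_algebra snd z"
    by (rule real_cond_exp_ge_c[OF int])
  with up cond_exp_linear show ?thesis by eventually_elim simp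
qed

text \<open>
  Under an integral against a bounded function of the covariates, \<open>Y\<close> may be replaced by its
  conditional expectation.
\<close>

lemma integral_tower:
  fixes h :: "real^'p \<Rightarrow> real"
  assumes [measurable]: "h \<in> borel_measurable borel" and "AE z in P. \<bar>h (fst z)\<bar> \<le> c"
  shows "(\<integral>z. h (fst z) * snd z \<partial>P) = (\<integral>z. h (fst z) * (fst z \<bullet> \<beta>star) \<partial>P)"
proof -
  interpret finite_measure_subalgebra P covariate_algebra by (rule subalgebra_covariates)
  have hF: "(\<lambda>z. h (fst z)) \<in> borel_measurable covariate_algebra"
    by (rule measurable_compose[OF measurable_vimage_algebra1]) auto
  have int: "integrable P (\<lambda>z. h (fst z) * snd z)"
    using AE_mult_bounded[OF assms(2) AE_Y_le] by (rule integrable_bounded[rotated]) measurable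
  have "(\<integral>z. h (fst z) * snd z \<partial>P) = (\<integral>z. h (fst z) * real_cond_exp P covariate_algebra snd z \<partial>P)"
    by (rule real_cond_exp_intg(2)[symmetric]) (use int hF in auto)
  also have "\<dots> = (\<integral>z. h (fst z) * (fst z \<bullet> \<beta>star) \<partial>P)"
    using cond_exp_linear by (intro integral_cong_AE) auto
  finally show ?thesis .
qed

end

section \<open>Noise and Gram matrix of the semi-supervised sample\<close>

locale semi_supervised_linear_model =
  prob_space M + law: bounded_linear_law P fstar \<beta>star B\<^sub>Y B\<^sub>X
  for M :: "'w measure" and P :: "((real^'p) \<times> real) measure"
    and fstar :: "real^'p \<Rightarrow> real" and \<beta>star :: "real^'p" and B\<^sub>Y B\<^sub>X :: real +
  fixes n N :: nat and X :: "nat \<Rightarrow> 'w \<Rightarrow> real^'p" and Y :: "nat \<Rightarrow> 'w \<Rightarrow> real"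
  assumes n_pos: "1 \<le> n" and n_less_N: "n < N"
    and sample: "semi_supervised_sample M P n N X Y"
begin

lemma measurable_XY: "i \<in> {1..n} \<Longrightarrow> (\<lambda>\<omega>. (X i \<omega>, Y i \<omega>)) \<in> borel_measurable M"
  using sample unfolding semi_supervised_sample_def indep_vars_def by blast

lemma measurable_X: "i \<in> {1..N} \<Longrightarrow> X i \<in> borel_measurable M"
proof (cases "i \<in> {1..n}")
  case True
  then show ?thesis
    using measurable_compose[OF measurable_XY measurable_pair_coordinates(3)] by simp
next
  case False
  moreover assume "i \<in> {1..N}"
  ultimately have "i \<in> {n+1..N}" by simp
  then show ?thesis
    using sample unfolding semi_supervised_sample_def indep_vars_def by blast
qed

lemma distr_XY: "i \<in> {1..n} \<Longrightarrow> distr M borel (\<lambda>\<omega>. (X i \<omega>, Y i \<omega>)) = P"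
  using sample unfolding semi_supervised_sample_def by blast

lemma distr_X:
  assumes "i \<in> {n+1..N}"
  shows "distr M borel (X i) = distr P borel fst"
  using sample assms unfolding semi_supervised_sample_def marginal_X_def by blast

lemma expectation_labeled:
  fixes f :: "(real^'p) \<times> real \<Rightarrow> real"
  assumes "i \<in> {1..n}" and "f \<in> borel_measurable borel"
  shows "expectation (\<lambda>\<omega>. f (X i \<omega>, Y i \<omega>)) = (\<integral>z. f z \<partial>P)"
  using integral_distr[OF measurable_XY assms(2)] assms(1) by (simp add: distr_XY)

lemma expectation_unlabeled:
  fixes h :: "real^'p \<Rightarrow> real"
  assumes "i \<in> {n+1..N}" and "h \<in> borel_measurable borel"
  shows "expectation (\<lambda>\<omega>. h (X i \<omega>)) = (\<integral>z. h (fst z) \<partial>P)"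
proof -
  have "X i \<in> borel_measurable M" using assms(1) by (intro measurable_X) auto
  from integral_distr[OF this assms(2)] have "expectation (\<lambda>\<omega>. h (X i \<omega>)) = (\<integral>x. h x \<partial>distr P borel fst)"
    by (simp add: distr_X[OF assms(1)])
  also have "\<dots> = (\<integral>z. h (fst z) \<partial>P)"
    using assms(2) by (intro integral_distr) measurable
  finally show ?thesis .
qed

lemma AE_labeled:
  assumes "i \<in> {1..n}" and "AE z in P. Q z"
  shows "AE \<omega> in M. Q (X i \<omega>, Y i \<omega>)"
proof (rule AE_distrD[OF measurable_XY[OF assms(1)]])
  show "AE z in distr M borel (\<lambda>\<omega>. (X i \<omega>, Y i \<omega>)). Q z"
    unfolding distr_XY[OF assms(1)] by (rule assms(2))
qed

lemma AE_unlabeled: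
  fixes Q :: "real^'p \<Rightarrow> bool"
  assumes "i \<in> {n+1..N}" and "AE z in P. Q (fst z)" and "Measurable.pred borel Q"
  shows "AE \<omega> in M. Q (X i \<omega>)"
proof -
  have X: "X i \<in> borel_measurable M" using assms(1) by (intro measurable_X) auto
  have "fst \<in> measurable P borel" by measurable
  then have "AE x in distr M borel (X i). Q x"
    unfolding distr_X[OF assms(1)] using assms(2,3) by (subst AE_distr_iff) auto
  then show ?thesis by (rule AE_distrD[OF X])
qed

text \<open>
  Puts the labeled and the unlabeled observations into a single family of real variables indexed by
  \<open>{1..N}\<close>, so that results on sums of independent variables apply to the whole sample.
\<close>

definition score :: "((real^'p) \<times> real \<Rightarrow> real) \<Rightarrow> (real^'p \<Rightarrow> real) \<Rightarrow> nat \<Rightarrow> 'w \<Rightarrow> real" where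
  "score g h i \<omega> = (if i \<in> {1..n} then g (X i \<omega>, Y i \<omega>) else h (X i \<omega>))"

lemma indep_score:
  assumes "g \<in> borel_measurable borel" and "h \<in> borel_measurable borel"
  shows "indep_vars (\<lambda>_. borel) (score g h) {1..N}"
proof -
  have "indep_vars (\<lambda>_. borel)
    (\<lambda>i \<omega>. if i \<in> {1..n} then g (X i \<omega>, Y i \<omega>) else h (X i \<omega>)) ({1..n} \<union> {n+1..N})"
    using sample assms unfolding semi_supervised_sample_def
    by (intro indep_vars_union_of_blocks[where g = "\<lambda>_. g" and h = "\<lambda>_. h"]) auto
  moreover have "{1..n} \<union> {n+1..N} = {1..N}" using n_less_N by auto
  ultimately show ?thesis by (simp add: score_def[abs_def])
qed

lemma sum_split: "(\<Sum>i\<in>{1..N}. f i) = (\<Sum>i\<in>{1..n}. f i) + (\<Sum>i\<in>{n+1..N}. f i :: real)"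
  using sum.ub_add_nat[of 1 n f "N - n"] n_less_N by simp

lemma sum_expectation_score:
  assumes g: "g \<in> borel_measurable borel" and h: "h \<in> borel_measurable borel"
  shows "(\<Sum>i\<in>{1..N}. expectation (score g h i))
    = real n * (\<integral>z. g z \<partial>P) + (real N - real n) * (\<integral>z. h (fst z) \<partial>P)"
proof -
  have "(\<Sum>i\<in>{1..n}. expectation (score g h i)) = (\<Sum>i\<in>{1..n}. \<integral>z. g z \<partial>P)"
    by (intro sum.cong refl) (simp add: score_def[abs_def] expectation_labeled[OF _ g])
  moreover have "(\<Sum>i\<in>{n+1..N}. expectation (score g h i)) = (\<Sum>i\<in>{n+1..N}. \<integral>z. h (fst z) \<partial>P)"
    by (intro sum.cong refl) (simp add: score_def[abs_def] expectation_unlabeled[OF _ h])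
  ultimately show ?thesis
    unfolding sum_split using n_less_N by (simp add: of_nat_diff)
qed

lemma AE_score_le:
  assumes "AE z in P. \<bar>g z\<bar> \<le> c" and "AE z in P. \<bar>h (fst z)\<bar> \<le> c"
    and h: "h \<in> borel_measurable borel" and "i \<in> {1..N}"
  shows "AE \<omega> in M. \<bar>score g h i \<omega>\<bar> \<le> c"
proof (cases "i \<in> {1..n}")
  case True
  then show ?thesis using AE_labeled[OF True assms(1)] by (simp add: score_def)
next
  case False
  then have "i \<in> {n+1..N}" using assms(4) by simp
  from AE_unlabeled[OF this, of "\<lambda>x. \<bar>h x\<bar> \<le> c"] assms(2) h
  have "AE \<omega> in M. \<bar>h (X i \<omega>)\<bar> \<le> c" by simp
  moreover have "score g h i = (\<lambda>\<omega>. h (X i \<omega>))" using False by (auto simp: score_def)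
  ultimately show ?thesis by simp
qed

text \<open>
  Minus one half of the gradient at \<open>\<beta>star\<close> of the quadratic part of the lasso criterion.
\<close>

definition noise :: "'w \<Rightarrow> real^'p" where
  "noise \<omega> = (1 / real n) *\<^sub>R (\<Sum>i=1..n. Y i \<omega> *\<^sub>R X i \<omega>)
     - empirical_second_moment N (\<lambda>i. X i \<omega>) *v \<beta>star"

definition labeled_score :: "'p \<Rightarrow> (real^'p) \<times> real \<Rightarrow> real" where
  "labeled_score j z = (snd z / real n - (fst z \<bullet> \<beta>star) / real N) * fst z $ j"

definition unlabeled_score :: "'p \<Rightarrow> real^'p \<Rightarrow> real" where
  "unlabeled_score j x = - ((x \<bullet> \<beta>star) / real N) * x $ j"

lemma measurable_scores:
  "labeled_score j \<in> borel_measurable borel" "unlabeled_score j \<in> borel_measurable borel"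
  unfolding labeled_score_def unlabeled_score_def divide_inverse
  by (intro borel_measurable_continuous_onI continuous_intros)+

lemma noise_nth: "noise \<omega> $ j = (\<Sum>i\<in>{1..N}. score (labeled_score j) (unlabeled_score j) i \<omega>)"
proof -
  have "(\<Sum>i\<in>{1..n}. score (labeled_score j) (unlabeled_score j) i \<omega>)
      = (\<Sum>i\<in>{1..n}. Y i \<omega> * X i \<omega> $ j / real n - (X i \<omega> \<bullet> \<beta>star) * X i \<omega> $ j / real N)"
    by (intro sum.cong refl) (simp add: score_def labeled_score_def left_diff_distrib)
  moreover have "(\<Sum>i\<in>{n+1..N}. score (labeled_score j) (unlabeled_score j) i \<omega>)
      = (\<Sum>i\<in>{n+1..N}. - ((X i \<omega> \<bullet> \<beta>star) * X i \<omega> $ j / real N))"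
    by (intro sum.cong refl) (simp add: score_def unlabeled_score_def)
  ultimately have "(\<Sum>i\<in>{1..N}. score (labeled_score j) (unlabeled_score j) i \<omega>)
      = (\<Sum>i\<in>{1..n}. Y i \<omega> * X i \<omega> $ j / real n)
        - (\<Sum>i\<in>{1..N}. (X i \<omega> \<bullet> \<beta>star) * X i \<omega> $ j / real N)"
    unfolding sum_split by (simp add: sum_subtractf sum_negf)
  then show ?thesis
    by (simp add: noise_def empirical_second_moment_mult sum_divide_distrib)
qed

text \<open>
  With \<open>m = E[(X \<bullet> \<beta>star) X\<^sub>j] = E[Y X\<^sub>j]\<close>, a labeled term has mean \<open>m / n - m / N\<close> and an unlabeled one
  \<open>- m / N\<close>. The terms are centred only in total.
\<close>

lemma noise_mean_zero:
  "(\<Sum>i\<in>{1..N}. expectation (score (labeled_score j) (unlabeled_score j) i)) = 0"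
proof -
  define m where "m = (\<integral>z. (fst z \<bullet> \<beta>star) * fst z $ j \<partial>P)"
  have bound: "AE z in P. \<bar>fst z $ j\<bar> \<le> B\<^sub>X" by (rule law.AE_X_le)
  have i1: "integrable P (\<lambda>z. fst z $ j * snd z)"
    using AE_mult_bounded[OF bound law.AE_Y_le] by (rule law.integrable_bounded[rotated]) measurable
  have i2: "integrable P (\<lambda>z. fst z $ j * (fst z \<bullet> \<beta>star))"
    using AE_mult_bounded[OF bound law.AE_linear_le] by (rule law.integrable_bounded[rotated]) measurable
  have tower: "(\<integral>z. fst z $ j * snd z \<partial>P) = m"
    using law.integral_tower[of "\<lambda>x. x $ j", OF _ bound] by (simp add: m_def mult.commute)
  have "(\<integral>z. labeled_score j z \<partial>P)
      = (\<integral>z. (fst z $ j * snd z) / real n - (fst z $ j * (fst z \<bullet> \<beta>star)) / real N \<partial>P)"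
    by (intro Bochner_Integration.integral_cong refl) (simp add: labeled_score_def algebra_simps)
  also have "\<dots> = m / real n - m / real N"
    using i1 i2 tower by (simp add: m_def mult.commute)
  finally have lab: "(\<integral>z. labeled_score j z \<partial>P) = m / real n - m / real N" .
  have unlab: "(\<integral>z. unlabeled_score j (fst z) \<partial>P) = - (m / real N)"
    by (simp add: unlabeled_score_def m_def)
  show ?thesis
    unfolding sum_expectation_score[OF measurable_scores] lab unlab
    using n_pos n_less_N by (simp add: field_simps)
qed

lemma score_square:
  "(\<lambda>\<omega>. (score g h i \<omega>)\<^sup>2) = score (\<lambda>z. (g z)\<^sup>2) (\<lambda>x. (h x)\<^sup>2) i"
  by (auto simp: score_def)

text \<open>
  Let \<open>q = E[(X \<bullet> \<beta>star)\<^sup>2 X\<^sub>j\<^sup>2]\<close>. Conditioning on the covariates turns the cross moment of \<open>Y\<close> and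
  \<open>X \<bullet> \<beta>star\<close> into \<open>q\<close> as well. Summed over the sample, the squares of the Gram part contribute \<open>q / N\<close> and
  the cross terms \<open>- 2 q / N\<close>, so the Gram part only lowers the second moment.
\<close>

lemma noise_variance_le:
  "(\<Sum>i\<in>{1..N}. expectation (\<lambda>\<omega>. (score (labeled_score j) (unlabeled_score j) i \<omega>)\<^sup>2))
    \<le> B\<^sub>Y\<^sup>2 / real n"
proof -
  define q where "q = (\<integral>z. (fst z \<bullet> \<beta>star)\<^sup>2 * (fst z $ j)\<^sup>2 \<partial>P)"
  have q: "0 \<le> q" unfolding q_def by (intro integral_nonneg_AE) auto
  note meas = measurable_scores[of j]
  have X2: "AE z in P. \<bar>fst z $ j * fst z $ j\<bar> \<le> B\<^sub>X * B\<^sub>X"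
    by (intro AE_mult_bounded law.AE_X_le)
  have i1: "integrable P (\<lambda>z. (snd z)\<^sup>2 * (fst z $ j)\<^sup>2)"
    using AE_mult_bounded[OF AE_mult_bounded[OF law.AE_Y_le law.AE_Y_le] X2]
    unfolding power2_eq_square by (rule law.integrable_bounded[rotated]) measurable
  have i2: "integrable P (\<lambda>z. (fst z \<bullet> \<beta>star)\<^sup>2 * (fst z $ j)\<^sup>2)"
    using AE_mult_bounded[OF AE_mult_bounded[OF law.AE_linear_le law.AE_linear_le] X2]
    unfolding power2_eq_square by (rule law.integrable_bounded[rotated]) measurable
  have bound: "AE z in P. \<bar>(fst z \<bullet> \<beta>star) * (fst z $ j * fst z $ j)\<bar> \<le> B\<^sub>Y * (B\<^sub>X * B\<^sub>X)"
    by (rule AE_mult_bounded[OF law.AE_linear_le X2])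
  have i3: "integrable P (\<lambda>z. ((fst z \<bullet> \<beta>star) * (fst z $ j * fst z $ j)) * snd z)"
    using AE_mult_bounded[OF bound law.AE_Y_le] by (rule law.integrable_bounded[rotated]) measurable
  have tower: "(\<integral>z. ((fst z \<bullet> \<beta>star) * (fst z $ j * fst z $ j)) * snd z \<partial>P) = q"
    using law.integral_tower[of "\<lambda>x. (x \<bullet> \<beta>star) * (x $ j * x $ j)", OF _ bound]
    by (simp add: q_def power2_eq_square mult_ac)
  have y2: "(\<integral>z. (snd z)\<^sup>2 * (fst z $ j)\<^sup>2 \<partial>P) \<le> B\<^sub>Y\<^sup>2"
  proof -
    have "(\<integral>z. (snd z)\<^sup>2 * (fst z $ j)\<^sup>2 \<partial>P) \<le> (\<integral>z. B\<^sub>Y\<^sup>2 * (fst z $ j)\<^sup>2 \<partial>P)"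
    proof (rule integral_mono_AE[OF i1])
      show "integrable P (\<lambda>z. B\<^sub>Y\<^sup>2 * (fst z $ j)\<^sup>2)" using law.integrable_X_sq by simp
      show "AE z in P. (snd z)\<^sup>2 * (fst z $ j)\<^sup>2 \<le> B\<^sub>Y\<^sup>2 * (fst z $ j)\<^sup>2"
        using law.AE_Y_le
      proof eventually_elim
        case (elim z)
        then have "\<bar>snd z\<bar> \<le> \<bar>B\<^sub>Y\<bar>" by linarith
        then have "(snd z)\<^sup>2 \<le> B\<^sub>Y\<^sup>2" by (simp add: abs_le_square_iff)
        then show ?case by (rule mult_right_mono) simp
      qed
    qed
    then show ?thesis using law.integral_X_sq by simp
  qed
  have "(\<integral>z. (labeled_score j z)\<^sup>2 \<partial>P)
      = (\<integral>z. (1 / (real n)\<^sup>2) * ((snd z)\<^sup>2 * (fst z $ j)\<^sup>2)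
          - (2 / (real n * real N)) * (((fst z \<bullet> \<beta>star) * (fst z $ j * fst z $ j)) * snd z)
          + (1 / (real N)\<^sup>2) * ((fst z \<bullet> \<beta>star)\<^sup>2 * (fst z $ j)\<^sup>2) \<partial>P)"
  proof (intro Bochner_Integration.integral_cong refl)
    fix z
    have "((a / s - f / t) * x)\<^sup>2 = (1 / s\<^sup>2) * (a\<^sup>2 * x\<^sup>2) - (2 / (s * t)) * ((f * (x * x)) * a)
        + (1 / t\<^sup>2) * (f\<^sup>2 * x\<^sup>2)" for a s f t x :: real
      by (simp add: power2_eq_square divide_inverse algebra_simps)
    then show "(labeled_score j z)\<^sup>2 = (1 / (real n)\<^sup>2) * ((snd z)\<^sup>2 * (fst z $ j)\<^sup>2)
          - (2 / (real n * real N)) * (((fst z \<bullet> \<beta>star) * (fst z $ j * fst z $ j)) * snd z)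
          + (1 / (real N)\<^sup>2) * ((fst z \<bullet> \<beta>star)\<^sup>2 * (fst z $ j)\<^sup>2)"
      unfolding labeled_score_def by blast
  qed
  also have "\<dots> = (1 / (real n)\<^sup>2) * (\<integral>z. (snd z)\<^sup>2 * (fst z $ j)\<^sup>2 \<partial>P)
      - (2 / (real n * real N)) * q + (1 / (real N)\<^sup>2) * q"
    using i1 i2 i3 tower by (simp add: q_def)
  also have "\<dots> \<le> (1 / (real n)\<^sup>2) * B\<^sub>Y\<^sup>2 - (2 / (real n * real N)) * q + (1 / (real N)\<^sup>2) * q"
    using y2 by (intro add_right_mono diff_right_mono mult_left_mono) auto
  finally have lab: "(\<integral>z. (labeled_score j z)\<^sup>2 \<partial>P)
      \<le> (1 / (real n)\<^sup>2) * B\<^sub>Y\<^sup>2 - (2 / (real n * real N)) * q + (1 / (real N)\<^sup>2) * q" .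
  have unlab: "(\<integral>z. (unlabeled_score j (fst z))\<^sup>2 \<partial>P) = (1 / (real N)\<^sup>2) * q"
    by (simp add: unlabeled_score_def q_def power_mult_distrib power_divide)
  have "(\<Sum>i\<in>{1..N}. expectation (\<lambda>\<omega>. (score (labeled_score j) (unlabeled_score j) i \<omega>)\<^sup>2))
      = real n * (\<integral>z. (labeled_score j z)\<^sup>2 \<partial>P)
        + (real N - real n) * (\<integral>z. (unlabeled_score j (fst z))\<^sup>2 \<partial>P)"
    unfolding score_square using meas by (intro sum_expectation_score borel_measurable_power) auto
  also have "\<dots> \<le> real n * ((1 / (real n)\<^sup>2) * B\<^sub>Y\<^sup>2 - (2 / (real n * real N)) * q + (1 / (real N)\<^sup>2) * q)
        + (real N - real n) * ((1 / (real N)\<^sup>2) * q)"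
    unfolding unlab by (intro add_right_mono mult_left_mono lab) simp
  also have "\<dots> = B\<^sub>Y\<^sup>2 / real n - q / real N"
    using n_pos n_less_N by (simp add: field_simps power2_eq_square)
  also have "\<dots> \<le> B\<^sub>Y\<^sup>2 / real n" using q by simp
  finally show ?thesis .
qed

lemma noise_score_bounded:
  assumes "i \<in> {1..N}"
  shows "AE \<omega> in M. \<bar>score (labeled_score j) (unlabeled_score j) i \<omega>\<bar> \<le> 2 * B\<^sub>Y * B\<^sub>X / real n"
proof (rule AE_score_le[OF _ _ measurable_scores(2) assms])
  have nN: "0 < real n" "real n \<le> real N" using n_pos n_less_N by auto
  have BN: "B\<^sub>Y / real N \<le> B\<^sub>Y / real n"
    using nN law.B\<^sub>Y_nonneg by (intro divide_left_mono) auto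
  have lin: "\<bar>x / real N\<bar> \<le> B\<^sub>Y / real n" if "\<bar>x\<bar> \<le> B\<^sub>Y" for x
  proof -
    have "\<bar>x / real N\<bar> \<le> B\<^sub>Y / real N" using that by (simp add: divide_right_mono)
    then show ?thesis using BN by linarith
  qed
  show "AE z in P. \<bar>labeled_score j z\<bar> \<le> 2 * B\<^sub>Y * B\<^sub>X / real n"
    using law.AE_Y_le law.AE_linear_le law.AE_X_le[of j]
  proof eventually_elim
    case (elim z)
    have "\<bar>snd z / real n\<bar> \<le> B\<^sub>Y / real n" using elim(1) by (simp add: divide_right_mono)
    with lin[OF elim(2)] have "\<bar>snd z / real n - (fst z \<bullet> \<beta>star) / real N\<bar> \<le> 2 * B\<^sub>Y / real n"
      by linarith
    then have "\<bar>snd z / real n - (fst z \<bullet> \<beta>star) / real N\<bar> * \<bar>fst z $ j\<bar> \<le> (2 * B\<^sub>Y / real n) * B\<^sub>X"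
      using elim(3) law.B\<^sub>Y_nonneg by (intro mult_mono) auto
    then show ?case by (simp add: labeled_score_def abs_mult)
  qed
  show "AE z in P. \<bar>unlabeled_score j (fst z)\<bar> \<le> 2 * B\<^sub>Y * B\<^sub>X / real n"
    using law.AE_linear_le law.AE_X_le[of j]
  proof eventually_elim
    case (elim z)
    have "\<bar>(fst z \<bullet> \<beta>star) / real N\<bar> * \<bar>fst z $ j\<bar> \<le> (B\<^sub>Y / real n) * B\<^sub>X"
      using lin[OF elim(1)] elim(2) law.B\<^sub>Y_nonneg by (intro mult_mono) auto
    also have "\<dots> \<le> 2 * B\<^sub>Y * B\<^sub>X / real n"
      using law.B\<^sub>Y_nonneg law.B\<^sub>X_nonneg by (simp add: divide_right_mono)
    finally show ?case by (simp add: unlabeled_score_def abs_mult)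
  qed
qed

lemma measurable_score:
  assumes "g \<in> borel_measurable borel" "h \<in> borel_measurable borel" "i \<in> {1..N}"
  shows "score g h i \<in> borel_measurable M"
  using indep_score[OF assms(1,2)] assms(3) unfolding indep_vars_def by blast

lemma measurable_noise: "(\<lambda>\<omega>. noise \<omega> $ j) \<in> borel_measurable M"
  unfolding noise_nth using measurable_score[OF measurable_scores] by (intro borel_measurable_sum) auto

text \<open>
  Bernstein's inequality with variance proxy \<open>B\<^sub>Y\<^sup>2 / n\<close> and range \<open>2 B\<^sub>Y B\<^sub>X / n\<close>. The lower bound on
  \<open>lam\<close> dominates its threshold because \<open>sqrt 2 \<le> 2\<close> and \<open>2 / 3 \<le> 1\<close>.
\<close>

lemma prob_coordinate_noise_large:
  assumes "0 < B\<^sub>Y" and "0 < L"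
    and lam: "4 * B\<^sub>Y * sqrt (L / real n) * (1 + B\<^sub>X / 2 * sqrt (L / real n)) \<le> lam"
  shows "prob {\<omega> \<in> space M. lam / 2 \<le> \<bar>noise \<omega> $ j\<bar>} \<le> 2 * exp (- L)"
  unfolding noise_nth
proof (rule Bernstein_ineq_abs_ge)
  show "indep_vars (\<lambda>_. borel) (score (labeled_score j) (unlabeled_score j)) {1..N}"
    by (rule indep_score[OF measurable_scores])
  show "0 < B\<^sub>Y\<^sup>2 / real n" using assms(1) n_pos by simp
  show "0 \<le> 2 * B\<^sub>Y * B\<^sub>X / real n" using law.B\<^sub>Y_nonneg law.B\<^sub>X_nonneg by simp
  define w where "w = sqrt (L / real n)"
  have w: "0 \<le> w" "w\<^sup>2 = L / real n" using \<open>0 < L\<close> by (simp_all add: w_def)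
  have "sqrt (2 * (B\<^sub>Y\<^sup>2 / real n) * L) = sqrt 2 * (B\<^sub>Y * w)"
    using law.B\<^sub>Y_nonneg by (simp add: w_def real_sqrt_mult[symmetric] real_sqrt_divide real_sqrt_mult)
  also have "\<dots> \<le> 2 * (B\<^sub>Y * w)"
    using law.B\<^sub>Y_nonneg w(1) sqrt2_less_2 by (intro mult_right_mono) auto
  finally have "sqrt (2 * (B\<^sub>Y\<^sup>2 / real n) * L) \<le> 2 * B\<^sub>Y * w" by simp
  moreover have "2 * B\<^sub>Y * B\<^sub>X / real n * L / 3 \<le> B\<^sub>Y * B\<^sub>X * w\<^sup>2"
  proof -
    have "2 * B\<^sub>Y * B\<^sub>X / real n * L / 3 = 2 / 3 * (B\<^sub>Y * B\<^sub>X * w\<^sup>2)" by (simp add: w(2))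
    also have "\<dots> \<le> 1 * (B\<^sub>Y * B\<^sub>X * w\<^sup>2)"
      using law.B\<^sub>Y_nonneg law.B\<^sub>X_nonneg by (intro mult_right_mono) auto
    finally show ?thesis by simp
  qed
  moreover have "2 * B\<^sub>Y * w + B\<^sub>Y * B\<^sub>X * w\<^sup>2 \<le> lam / 2"
    using lam unfolding w_def[symmetric] by (simp add: algebra_simps power2_eq_square)
  ultimately show "sqrt (2 * (B\<^sub>Y\<^sup>2 / real n) * L) + 2 * B\<^sub>Y * B\<^sub>X / real n * L / 3 \<le> lam / 2"
    by linarith
qed (use assms noise_mean_zero noise_variance_le noise_score_bounded in auto)

text \<open>
  Hoeffding's inequality for products of coordinates, which lie in an interval of length \<open>2 B\<^sub>X\<^sup>2\<close>.
\<close>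

lemma prob_coordinate_gram_error_large:
  assumes "0 \<le> L"
  shows "prob {\<omega> \<in> space M. B\<^sub>X\<^sup>2 * sqrt (2 * L / real N)
      \<le> \<bar>empirical_second_moment N (\<lambda>i. X i \<omega>) $ j $ k - second_moment P $ j $ k\<bar>} \<le> 2 * exp (- L)"
proof -
  define V where "V = score (\<lambda>z. fst z $ j * fst z $ k) (\<lambda>x. x $ j * x $ k)"
  have meas: "(\<lambda>z :: (real^'p) \<times> real. fst z $ j * fst z $ k) \<in> borel_measurable borel"
    "(\<lambda>x :: real^'p. x $ j * x $ k) \<in> borel_measurable borel"
    by (intro borel_measurable_continuous_onI continuous_intros)+
  have V: "V i \<omega> = X i \<omega> $ j * X i \<omega> $ k" for i \<omega>
    by (simp add: V_def score_def)
  have Np: "0 < real N" using n_less_N by simp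
  define \<mu> where "\<mu> = (\<Sum>i\<in>{1..N}. expectation (V i))"
  have \<mu>: "\<mu> = real N * second_moment P $ j $ k"
    unfolding \<mu>_def V_def sum_expectation_score[OF meas]
    by (simp add: law.second_moment_nth algebra_simps)
  interpret H: Hoeffding_ineq M "{1..N}" V "\<lambda>_. - B\<^sub>X\<^sup>2" "\<lambda>_. B\<^sub>X\<^sup>2" \<mu>
  proof unfold_locales
    show "indep_vars (\<lambda>_. borel) V {1..N}"
      unfolding V_def by (rule indep_score[OF meas])
    fix i assume i: "i \<in> {1..N}"
    have "AE \<omega> in M. \<bar>V i \<omega>\<bar> \<le> B\<^sub>X\<^sup>2"
      unfolding V_def using law.AE_XX_le i by (intro AE_score_le meas) auto
    then show "AE \<omega> in M. V i \<omega> \<in> {- B\<^sub>X\<^sup>2..B\<^sub>X\<^sup>2}" by eventually_elim auto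
  qed (auto simp: \<mu>_def)
  define t where "t = B\<^sub>X\<^sup>2 * sqrt (2 * L / real N)"
  have t: "0 \<le> t" using assms by (simp add: t_def)
  have width: "(\<Sum>i\<in>{1..N}. (B\<^sub>X\<^sup>2 - (- B\<^sub>X\<^sup>2))\<^sup>2) = real N * (4 * (B\<^sub>X\<^sup>2)\<^sup>2)"
    by (simp add: power2_eq_square)
  have "prob {\<omega> \<in> space M. real N * t \<le> \<bar>(\<Sum>i\<in>{1..N}. V i \<omega>) - \<mu>\<bar>}
      \<le> 2 * exp (- 2 * (real N * t)\<^sup>2 / (\<Sum>i\<in>{1..N}. (B\<^sub>X\<^sup>2 - (- B\<^sub>X\<^sup>2))\<^sup>2))"
    using t Np law.B\<^sub>X_pos unfolding width by (intro H.Hoeffding_ineq_abs_ge[unfolded width]) auto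
  also have "- 2 * (real N * t)\<^sup>2 / (\<Sum>i\<in>{1..N}. (B\<^sub>X\<^sup>2 - (- B\<^sub>X\<^sup>2))\<^sup>2) = - L"
  proof -
    have "(real N * t)\<^sup>2 = real N * (B\<^sub>X\<^sup>2)\<^sup>2 * (2 * L)"
      using assms Np by (simp add: t_def power_mult_distrib power2_eq_square[of "real N"])
    then show ?thesis unfolding width using Np law.B\<^sub>X_pos by simp
  qed
  also have "{\<omega> \<in> space M. real N * t \<le> \<bar>(\<Sum>i\<in>{1..N}. V i \<omega>) - \<mu>\<bar>}
      = {\<omega> \<in> space M. t \<le> \<bar>empirical_second_moment N (\<lambda>i. X i \<omega>) $ j $ k - second_moment P $ j $ k\<bar>}"
  proof -
    have "\<bar>(\<Sum>i\<in>{1..N}. V i \<omega>) - \<mu>\<bar>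
      = real N * \<bar>empirical_second_moment N (\<lambda>i. X i \<omega>) $ j $ k - second_moment P $ j $ k\<bar>" for \<omega>
    proof -
      have "(\<Sum>i\<in>{1..N}. V i \<omega>) - \<mu>
          = real N * (empirical_second_moment N (\<lambda>i. X i \<omega>) $ j $ k - second_moment P $ j $ k)"
        using Np by (simp add: V \<mu> empirical_second_moment_nth right_diff_distrib)
      then show ?thesis by (simp add: abs_mult)
    qed
    then show ?thesis using Np by simp
  qed
  finally show ?thesis by (simp only: t_def)
qed

end

section \<open>Measurability of the risk bounds\<close>

text \<open>
  An infimum of continuous functions is upper semicontinuous: its strict sublevel sets are unions of
  open sets, however large the index set is.
\<close>

lemma borel_measurable_INF_continuous:
  fixes g :: "'v \<Rightarrow> 'a::topological_space \<Rightarrow> real"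
  assumes "\<And>v. v \<in> V \<Longrightarrow> continuous_on UNIV (g v)"
  shows "(\<lambda>A. INF v\<in>V. ereal (g v A)) \<in> borel_measurable borel"
proof (rule borel_measurableI_less)
  fix y :: ereal
  have "{A. (INF v\<in>V. ereal (g v A)) < y} = (\<Union>v\<in>V. {A. ereal (g v A) < y})"
    by (auto simp: INF_less_iff)
  also have "open \<dots>"
    using assms by (intro open_UN ballI open_Collect_less continuous_on_ereal continuous_on_const)
  finally show "{A \<in> space borel. (INF v\<in>V. ereal (g v A)) < y} \<in> sets borel"
    by simp
qed

lemma continuous_on_quadratic_form:
  fixes v :: "real^'n"
  shows "continuous_on UNIV (\<lambda>A :: real^'n^'n. v \<bullet> (A *v v))"
  unfolding quadratic_form_sum by (intro continuous_intros)

lemma measurable_compatibility: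
  fixes A :: "'w \<Rightarrow> real^'n^'n"
  assumes A: "A \<in> borel_measurable M" and psd: "\<And>\<omega>. psd (A \<omega>)"
  shows "(\<lambda>\<omega>. compatibility (A \<omega>) J c) \<in> borel_measurable M"
  unfolding compatibility_quadratic[OF psd] divide_inverse
  by (intro measurable_compose[OF A] borel_measurable_INF_continuous continuous_intros
      continuous_on_quadratic_form)

lemma measurable_restricted_eigenvalue:
  fixes A :: "'w \<Rightarrow> real^'n^'n"
  assumes A: "A \<in> borel_measurable M" and psd: "\<And>\<omega>. psd (A \<omega>)"
  shows "(\<lambda>\<omega>. restricted_eigenvalue (A \<omega>) s c) \<in> borel_measurable M"
proof -
  have "{J :: 'n set. card J \<le> s} \<noteq> {}" by (auto intro: exI[of _ "{}"])
  then have "restricted_eigenvalue B s c = (INF J\<in>{J. card J \<le> s}. restricted_eigenvalue_on B J c)"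
    for B :: "real^'n^'n"
    unfolding restricted_eigenvalue_def by (intro Min_Inf) auto
  moreover have "(\<lambda>\<omega>. restricted_eigenvalue_on (A \<omega>) J c) \<in> borel_measurable M" for J
    unfolding restricted_eigenvalue_on_quadratic[OF psd]
    by (intro measurable_compose[OF A] borel_measurable_INF_continuous continuous_on_quadratic_form)
  ultimately show ?thesis by (simp add: borel_measurable_INF)
qed

section \<open>Excess risk of the semi-supervised lasso\<close>

context semi_supervised_linear_model
begin

lemma measurable_empirical_second_moment:
  "(\<lambda>\<omega>. empirical_second_moment N (\<lambda>i. X i \<omega>)) \<in> borel_measurable M"
proof -
  have "continuous_on UNIV (outer :: real^'p \<Rightarrow> _)"
    unfolding outer_def[abs_def] by (intro continuous_intros)
  then have outer: "outer \<in> borel_measurable (borel :: (real^'p) measure)"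
    by (rule borel_measurable_continuous_onI)
  have "(\<lambda>\<omega>. outer (X i \<omega>)) \<in> borel_measurable M" if "i \<in> {1..N}" for i
    using measurable_compose[OF measurable_X[OF that] outer] .
  then show ?thesis
    unfolding empirical_second_moment_def
    by (intro borel_measurable_scaleR borel_measurable_const borel_measurable_sum) auto
qed

lemma prob_noise_large:
  assumes "0 < B\<^sub>Y" and \<delta>: "0 < \<delta>" "\<delta> < 1"
    and lam: "4 * B\<^sub>Y * sqrt (ln (4 * real CARD('p) / \<delta>) / real n)
           * (1 + B\<^sub>X / 2 * sqrt (ln (4 * real CARD('p) / \<delta>) / real n)) \<le> lam"
  shows "{\<omega> \<in> space M. \<exists>j. lam / 2 \<le> \<bar>noise \<omega> $ j\<bar>} \<in> events"
    and "prob {\<omega> \<in> space M. \<exists>j. lam / 2 \<le> \<bar>noise \<omega> $ j\<bar>} \<le> \<delta> / 2"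
proof -
  let ?p = "real CARD('p)" and ?E = "\<lambda>j. {\<omega> \<in> space M. lam / 2 \<le> \<bar>noise \<omega> $ j\<bar>}"
  define L where "L = ln (4 * ?p / \<delta>)"
  have p: "1 \<le> ?p" by (simp add: Suc_leI)
  have "\<delta> < 4 * ?p" using p \<delta> by linarith
  then have gt1: "1 < 4 * ?p / \<delta>" using \<delta> by (simp add: pos_less_divide_eq)
  then have L: "0 < L" by (simp add: L_def)
  have expL: "exp (- L) = \<delta> / (4 * ?p)"
    using gt1 by (simp add: L_def exp_minus)
  have ev: "?E j \<in> events" for j
    using measurable_noise[of j] by measurable
  have eq: "{\<omega> \<in> space M. \<exists>j. lam / 2 \<le> \<bar>noise \<omega> $ j\<bar>} = (\<Union>j\<in>UNIV. ?E j)" by auto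
  show "{\<omega> \<in> space M. \<exists>j. lam / 2 \<le> \<bar>noise \<omega> $ j\<bar>} \<in> events"
    unfolding eq using ev by (intro sets.finite_UN) auto
  have "prob (\<Union>j\<in>UNIV. ?E j) \<le> (\<Sum>j\<in>UNIV. prob (?E j))"
    using ev by (intro finite_measure_subadditive_finite) auto
  also have "\<dots> \<le> (\<Sum>j\<in>(UNIV :: 'p set). 2 * (\<delta> / (4 * ?p)))"
    using prob_coordinate_noise_large[OF assms(1) L lam[folded L_def]]
    by (intro sum_mono) (simp add: expL)
  also have "\<dots> = \<delta> / 2" by simp
  finally show "prob {\<omega> \<in> space M. \<exists>j. lam / 2 \<le> \<bar>noise \<omega> $ j\<bar>} \<le> \<delta> / 2" unfolding eq .
qed

lemma prob_gram_error_large: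
  assumes \<delta>: "0 < \<delta>" "\<delta> < 1"
  defines "t \<equiv> B\<^sub>X\<^sup>2 * sqrt (2 * ln (4 * (real CARD('p))\<^sup>2 / \<delta>) / real N)"
  defines "F \<equiv> {\<omega> \<in> space M. \<exists>j k.
     t \<le> \<bar>empirical_second_moment N (\<lambda>i. X i \<omega>) $ j $ k - second_moment P $ j $ k\<bar>}"
  shows "F \<in> events" and "prob F \<le> \<delta> / 2"
proof -
  let ?p = "real CARD('p)"
  let ?E = "\<lambda>(j, k). {\<omega> \<in> space M.
     t \<le> \<bar>empirical_second_moment N (\<lambda>i. X i \<omega>) $ j $ k - second_moment P $ j $ k\<bar>}"
  define L where "L = ln (4 * ?p\<^sup>2 / \<delta>)"
  have "1 \<le> ?p" by (simp add: Suc_leI)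
  then have p: "1 \<le> ?p\<^sup>2" by (rule one_le_power)
  have "\<delta> < 4 * ?p\<^sup>2" using p \<delta> by linarith
  then have gt1: "1 < 4 * ?p\<^sup>2 / \<delta>" using \<delta> by (simp add: pos_less_divide_eq)
  then have L: "0 \<le> L" by (simp add: L_def)
  have expL: "exp (- L) = \<delta> / (4 * ?p\<^sup>2)"
    using gt1 by (simp add: L_def exp_minus)
  have ev: "?E x \<in> events" for x
  proof (cases x)
    case (Pair j k)
    have "(\<lambda>A :: real^'p^'p. A $ j $ k) \<in> borel_measurable borel"
      by (intro borel_measurable_continuous_onI continuous_intros)
    from measurable_compose[OF measurable_empirical_second_moment this]
    show ?thesis unfolding Pair prod.case by measurable
  qed
  have eq: "F = (\<Union>x\<in>UNIV. ?E x)" unfolding F_def by auto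
  show "F \<in> events" unfolding eq using ev by (intro sets.finite_UN) auto
  have "prob F \<le> (\<Sum>x\<in>UNIV. prob (?E x))"
    unfolding eq using ev by (intro finite_measure_subadditive_finite) auto
  also have "\<dots> \<le> (\<Sum>x\<in>(UNIV :: ('p \<times> 'p) set). 2 * (\<delta> / (4 * ?p\<^sup>2)))"
  proof (rule sum_mono)
    fix x :: "'p \<times> 'p"
    show "prob (?E x) \<le> 2 * (\<delta> / (4 * ?p\<^sup>2))"
      using prob_coordinate_gram_error_large[OF L, of "fst x" "snd x", unfolded expL]
      unfolding t_def L_def by (simp add: case_prod_beta)
  qed
  also have "\<dots> = \<delta> / 2" by (simp add: power2_eq_square)
  finally show "prob F \<le> \<delta> / 2" .
qed

lemma lasso_error_in_cone:
  assumes lam: "0 < lam"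
    and min: "is_arg_min (lasso_objective n N lam (\<lambda>i. X i \<omega>) (\<lambda>i. Y i \<omega>)) (\<lambda>_. True) \<beta>"
    and noise: "\<And>j. \<bar>noise \<omega> $ j\<bar> < lam / 2"
    and J: "J = {j. \<beta>star $ j \<noteq> 0}" and neq: "\<beta> \<noteq> \<beta>star"
  shows "(\<beta> - \<beta>star) \<bullet> (empirical_second_moment N (\<lambda>i. X i \<omega>) *v (\<beta> - \<beta>star))
    < lam / 2 * (3 * l1_norm (restrict_vec J (\<beta> - \<beta>star)) - l1_norm (restrict_vec (- J) (\<beta> - \<beta>star)))"
proof -
  define b where "b = (1 / real n) *\<^sub>R (\<Sum>i=1..n. Y i \<omega> *\<^sub>R X i \<omega>)"
  have obj: "lasso_objective n N lam (\<lambda>i. X i \<omega>) (\<lambda>i. Y i \<omega>) w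
      = w \<bullet> (empirical_second_moment N (\<lambda>i. X i \<omega>) *v w) - 2 * (b \<bullet> w) + 2 * lam * l1_norm w" for w
    by (simp add: lasso_objective_def norm_psd_sqrt[OF psd_empirical_second_moment] b_def
        inner_sum_left)
  show ?thesis
  proof (rule lasso_cone[OF psd_empirical_second_moment lam _ _ J neq])
    show "\<bar>(b - empirical_second_moment N (\<lambda>i. X i \<omega>) *v \<beta>star) $ j\<bar> < lam / 2" for j
      using noise[of j] by (simp add: noise_def b_def)
    show "\<beta> \<bullet> (empirical_second_moment N (\<lambda>i. X i \<omega>) *v \<beta>) - 2 * (b \<bullet> \<beta>) + 2 * lam * l1_norm \<beta>
      \<le> w \<bullet> (empirical_second_moment N (\<lambda>i. X i \<omega>) *v w) - 2 * (b \<bullet> w) + 2 * lam * l1_norm w" for w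
      using min unfolding is_arg_min_def obj[symmetric] by (simp add: not_less)
  qed
qed

text \<open>
  Both bounds hold for every outcome whose noise is below \<open>lam / 2\<close>. If the estimator equals \<open>\<beta>star\<close>, the
  risk is 0 and only the sign of the bounds matters; this covers the outcomes where the constants
  are infinite.
\<close>

lemma excess_risk_le_empirical_bound:
  assumes lam: "0 < lam"
    and min: "is_arg_min (lasso_objective n N lam (\<lambda>i. X i \<omega>) (\<lambda>i. Y i \<omega>)) (\<lambda>_. True) \<beta>"
    and noise: "\<And>j. \<bar>noise \<omega> $ j\<bar> < lam / 2"
    and J: "J = {j. \<beta>star $ j \<noteq> 0}" and A: "A = empirical_second_moment N (\<lambda>i. X i \<omega>)"
  shows "ereal (excess_risk P fstar (linear_predictor \<beta>))
    \<le> min ((ereal (6 * lam * real (card J)) / compatibility A J 3)\<^sup>2)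
          (ereal (9 * spectral_norm (second_moment P) * lam\<^sup>2 * real (card J))
             / (restricted_eigenvalue A (card J) 3)\<^sup>2)"
proof (cases "\<beta> = \<beta>star")
  case True
  then have "excess_risk P fstar (linear_predictor \<beta>) = 0"
    by (simp add: law.excess_risk_linear)
  moreover have "0 \<le> (ereal (6 * lam * real (card J)) / compatibility A J 3)\<^sup>2"
    using lam by (intro zero_le_power_ereal zero_le_divide_ereal compatibility_nonneg) simp
  moreover have "0 \<le> ereal (9 * spectral_norm (second_moment P) * lam\<^sup>2 * real (card J))
             / (restricted_eigenvalue A (card J) 3)\<^sup>2"
    using lam law.spectral_norm_pos
    by (intro zero_le_divide_ereal zero_le_power_ereal restricted_eigenvalue_nonneg) simp
  ultimately show ?thesis by (simp add: zero_ereal_def)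
next
  case False
  define u where "u = \<beta> - \<beta>star"
  have psd: "psd A" unfolding A by (rule psd_empirical_second_moment)
  note cone = lasso_error_in_cone[OF lam min noise J False, folded A u_def]
  have "ereal (u \<bullet> (second_moment P *v u)) \<le> ereal ((l1_norm u)\<^sup>2)"
    using quadratic_form_le_l1[of "second_moment P" 1 u] law.abs_second_moment_le_1 by simp
  also have "\<dots> \<le> (ereal (6 * lam * real (card J)) / compatibility A J 3)\<^sup>2"
    by (rule l1_error_le_compatibility[OF psd lam cone])
  finally have 1: "ereal (u \<bullet> (second_moment P *v u))
      \<le> (ereal (6 * lam * real (card J)) / compatibility A J 3)\<^sup>2" .
  have "ereal (u \<bullet> (second_moment P *v u)) \<le> ereal (spectral_norm (second_moment P) * (norm u)\<^sup>2)"
    using law.quadratic_le_spectral_norm by simp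
  also have "\<dots> \<le> ereal (9 * spectral_norm (second_moment P) * lam\<^sup>2 * real (card J))
             / (restricted_eigenvalue A (card J) 3)\<^sup>2"
    by (rule l2_error_le_restricted_eigenvalue[OF psd lam law.spectral_norm_pos cone])
  finally show ?thesis using 1 by (simp add: law.excess_risk_linear u_def)
qed

lemma excess_risk_le_population_bound:
  assumes lam: "0 < lam"
    and min: "is_arg_min (lasso_objective n N lam (\<lambda>i. X i \<omega>) (\<lambda>i. Y i \<omega>)) (\<lambda>_. True) \<beta>"
    and noise: "\<And>j. \<bar>noise \<omega> $ j\<bar> < lam / 2"
    and J: "J = {j. \<beta>star $ j \<noteq> 0}"
    and close: "\<And>j k. \<bar>empirical_second_moment N (\<lambda>i. X i \<omega>) $ j $ k - second_moment P $ j $ k\<bar> \<le> t"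
    and small: "ereal (16 * real (card J) * t) \<le> compatibility (second_moment P) J 3"
  shows "ereal (excess_risk P fstar (linear_predictor \<beta>))
    \<le> ereal (9 * lam\<^sup>2 * real (card J)) / compatibility (second_moment P) J 3"
proof (cases "\<beta> = \<beta>star")
  case True
  then have "excess_risk P fstar (linear_predictor \<beta>) = 0"
    by (simp add: law.excess_risk_linear)
  moreover have "0 \<le> ereal (9 * lam\<^sup>2 * real (card J)) / compatibility (second_moment P) J 3"
    by (intro zero_le_divide_ereal compatibility_nonneg) simp
  ultimately show ?thesis by (simp add: zero_ereal_def)
next
  case False
  show ?thesis
    unfolding law.excess_risk_linear
    by (rule prediction_error_le_population_compatibility[OF psd_empirical_second_moment
          law.psd_second_moment lam lasso_error_in_cone[OF lam min noise J False] close small])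
qed

lemma measurable_excess_risk:
  assumes "\<beta>hat \<in> borel_measurable M"
  shows "(\<lambda>\<omega>. ereal (excess_risk P fstar (linear_predictor (\<beta>hat \<omega>)))) \<in> borel_measurable M"
proof -
  have "(\<lambda>\<beta>. (\<beta> - \<beta>star) \<bullet> (second_moment P *v (\<beta> - \<beta>star))) \<in> borel_measurable borel"
    unfolding quadratic_form_sum by (intro borel_measurable_continuous_onI continuous_intros)
  from measurable_compose[OF assms this] show ?thesis
    unfolding law.excess_risk_linear by (intro borel_measurable_ereal)
qed

text \<open>
  Each bound holds outside an exceptional event: the first one outside the event of large noise, the
  second one outside this event and that of a large error of the Gram matrix. Each of the two has
  probability at most \<open>\<delta> / 2\<close>.
\<close>

theorem semi_supervised_lasso_excess_risk:
  assumes "0 < B\<^sub>Y" and \<delta>: "0 < \<delta>" "\<delta> < 1" and lam: "0 < lam"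
    and lam_ge: "4 * B\<^sub>Y * sqrt (ln (4 * real CARD('p) / \<delta>) / real n)
           * (1 + B\<^sub>X / 2 * sqrt (ln (4 * real CARD('p) / \<delta>) / real n)) \<le> lam"
    and meas: "\<beta>hat \<in> borel_measurable M"
    and min: "\<And>\<omega>. \<omega> \<in> space M \<Longrightarrow>
           is_arg_min (lasso_objective n N lam (\<lambda>i. X i \<omega>) (\<lambda>i. Y i \<omega>)) (\<lambda>_. True) (\<beta>hat \<omega>)"
    and J: "J = {j. \<beta>star $ j \<noteq> 0}"
  shows "1 - \<delta> \<le> prob {\<omega> \<in> space M.
      ereal (excess_risk P fstar (linear_predictor (\<beta>hat \<omega>)))
        \<le> min ((ereal (6 * lam * real (card J))
                  / compatibility (empirical_second_moment N (\<lambda>i. X i \<omega>)) J 3)\<^sup>2)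
              (ereal (9 * spectral_norm (second_moment P) * lam\<^sup>2 * real (card J))
                 / (restricted_eigenvalue (empirical_second_moment N (\<lambda>i. X i \<omega>)) (card J) 3)\<^sup>2)}"
    (is "_ \<le> prob ?S1")
    and "ereal (16 * real (card J) * B\<^sub>X\<^sup>2 * sqrt (2 * ln (4 * (real CARD('p))\<^sup>2 / \<delta>)))
           \<le> compatibility (second_moment P) J 3 * ereal (sqrt (real N)) \<Longrightarrow>
      1 - \<delta> \<le> prob {\<omega> \<in> space M. ereal (excess_risk P fstar (linear_predictor (\<beta>hat \<omega>)))
        \<le> ereal (9 * lam\<^sup>2 * real (card J)) / compatibility (second_moment P) J 3}"
    (is "?small \<Longrightarrow> _ \<le> prob ?S2")
proof -
  define F where "F = {\<omega> \<in> space M. \<exists>j. lam / 2 \<le> \<bar>noise \<omega> $ j\<bar>}"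
  have F: "F \<in> events" "prob F \<le> \<delta> / 2"
    unfolding F_def by (rule prob_noise_large[OF assms(1) \<delta> lam_ge])+
  have small_noise: "\<bar>noise \<omega> $ j\<bar> < lam / 2" if "\<omega> \<in> space M - F" for \<omega> j
    using that unfolding F_def by (auto simp: not_le)
  have le_event: "{\<omega> \<in> space M. ereal (excess_risk P fstar (linear_predictor (\<beta>hat \<omega>))) \<le> g \<omega>} \<in> events"
    if "g \<in> borel_measurable M" for g
    using measurable_excess_risk[OF meas] that by measurable
  have S1: "?S1 \<in> events"
    unfolding power2_eq_square[of "_ / _"] power2_eq_square[of "restricted_eigenvalue _ _ _"]
    by (intro le_event borel_measurable_min borel_measurable_ereal_times borel_measurable_ereal_divide
        borel_measurable_const measurable_compatibility measurable_restricted_eigenvalue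
        measurable_empirical_second_moment psd_empirical_second_moment)
  have F_le: "prob F \<le> \<delta>" using F \<delta> by simp
  have sub1: "space M - F \<subseteq> ?S1"
  proof
    fix \<omega> assume \<omega>: "\<omega> \<in> space M - F"
    then have "\<omega> \<in> space M" by simp
    with excess_risk_le_empirical_bound[OF lam min[OF this] small_noise[OF \<omega>] J refl]
    show "\<omega> \<in> ?S1" by simp
  qed
  from S1 F(1) F_le sub1 show "1 - \<delta> \<le> prob ?S1"
    by (rule prob_ge_if_bad_event)
  assume small: ?small
  define t where "t = B\<^sub>X\<^sup>2 * sqrt (2 * ln (4 * (real CARD('p))\<^sup>2 / \<delta>) / real N)"
  define G where "G = {\<omega> \<in> space M. \<exists>j k.
     t \<le> \<bar>empirical_second_moment N (\<lambda>i. X i \<omega>) $ j $ k - second_moment P $ j $ k\<bar>}"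
  have G: "G \<in> events" "prob G \<le> \<delta> / 2"
    unfolding G_def t_def by (rule prob_gram_error_large[OF \<delta>])+
  have sN: "0 < sqrt (real N)" using n_less_N by simp
  have "ereal (16 * real (card J) * t) \<le> compatibility (second_moment P) J 3"
  proof (cases "compatibility (second_moment P) J 3")
    case (real k)
    have "16 * real (card J) * t * sqrt (real N)
        = 16 * real (card J) * B\<^sub>X\<^sup>2 * sqrt (2 * ln (4 * (real CARD('p))\<^sup>2 / \<delta>))"
      using sN by (simp add: t_def real_sqrt_divide)
    also have "\<dots> \<le> k * sqrt (real N)"
      using small by (simp add: real)
    finally show ?thesis using sN by (simp add: real)
  qed (use compatibility_nonneg[of "second_moment P" J 3] in auto)
  note compat = this
  have "?S2 \<in> events" by (intro le_event borel_measurable_const)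
  moreover have "F \<union> G \<in> events" using F G by simp
  moreover have "prob (F \<union> G) \<le> \<delta>"
    using measure_Un_le[OF F(1) G(1)] F(2) G(2) by linarith
  moreover have "space M - (F \<union> G) \<subseteq> ?S2"
  proof
    fix \<omega> assume \<omega>: "\<omega> \<in> space M - (F \<union> G)"
    then have close: "\<bar>empirical_second_moment N (\<lambda>i. X i \<omega>) $ j $ k - second_moment P $ j $ k\<bar> \<le> t" for j k
      unfolding G_def by (auto simp: not_le intro: less_imp_le)
    from \<omega> have \<omega>': "\<omega> \<in> space M" "\<omega> \<in> space M - F" by auto
    with excess_risk_le_population_bound[OF lam min small_noise J close compat]
    show "\<omega> \<in> ?S2" by simp
  qed
  ultimately show "1 - \<delta> \<le> prob ?S2" by (rule prob_ge_if_bad_event)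
qed

end

theorem theorem6:
  fixes M :: "'w measure"
    and P :: "((real ^ 'p) \<times> real) measure"
    and n N :: nat
    and X :: "nat \<Rightarrow> 'w \<Rightarrow> real ^ 'p"
    and Y :: "nat \<Rightarrow> 'w \<Rightarrow> real"
    and fstar :: "real ^ 'p \<Rightarrow> real"
    and \<beta>star :: "real ^ 'p"
    and \<beta>hat :: "'w \<Rightarrow> real ^ 'p"
    and Jstar :: "'p set"
    and sstar :: nat
    and \<Sigma>all :: "'w \<Rightarrow> real ^ 'p ^ 'p"
    and B\<^sub>Y B\<^sub>X \<delta> lam :: real
  assumes "prob_space M" and "prob_space P" and "sets P = sets borel"
    and "1 \<le> n" and "n < N"
    and "semi_supervised_sample M P n N X Y"
    and A1: "standardized P"
    and A2: "bounded_data P B\<^sub>Y B\<^sub>X"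
    and "regression_function P fstar"
    and well_specified: "AE x in marginal_X P. fstar x = x \<bullet> \<beta>star"
    and "Jstar = {j. \<beta>star $ j \<noteq> 0}" and "sstar = card Jstar"
    and "0 < \<delta>" and "\<delta> < 1"
    and "0 < lam"
    and "4 * B\<^sub>Y * sqrt (ln (4 * real CARD('p) / \<delta>) / real n)
           * (1 + B\<^sub>X / 2 * sqrt (ln (4 * real CARD('p) / \<delta>) / real n)) \<le> lam"
    and "\<And>\<omega>. \<Sigma>all \<omega> = empirical_second_moment N (\<lambda>i. X i \<omega>)"
    and "\<beta>hat \<in> borel_measurable M"
    and "\<And>\<omega>. \<omega> \<in> space M \<Longrightarrow>
           is_arg_min (lasso_objective n N lam (\<lambda>i. X i \<omega>) (\<lambda>i. Y i \<omega>)) (\<lambda>_. True) (\<beta>hat \<omega>)"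
  shows "measure M {\<omega> \<in> space M.
           ereal (excess_risk P fstar (linear_predictor (\<beta>hat \<omega>)))
             \<le> min ((ereal (6 * lam * real sstar) / compatibility (\<Sigma>all \<omega>) Jstar 3)\<^sup>2)
                   (ereal (9 * spectral_norm (second_moment P) * lam\<^sup>2 * real sstar)
                      / (restricted_eigenvalue (\<Sigma>all \<omega>) sstar 3)\<^sup>2)} \<ge> 1 - \<delta>
       \<and> (ereal (16 * real sstar * B\<^sub>X\<^sup>2 * sqrt (2 * ln (4 * (real CARD('p))\<^sup>2 / \<delta>)))
             \<le> compatibility (second_moment P) Jstar 3 * ereal (sqrt (real N))
           \<longrightarrow> measure M {\<omega> \<in> space M.
                 ereal (excess_risk P fstar (linear_predictor (\<beta>hat \<omega>)))
                   \<le> ereal (9 * lam\<^sup>2 * real sstar) / compatibility (second_moment P) Jstar 3} \<ge> 1 - \<delta>)"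
proof -
  interpret given: bounded_linear_law P fstar \<beta>star B\<^sub>Y B\<^sub>X
    by (intro bounded_linear_law.intro bounded_linear_law_axioms.intro
        \<open>prob_space P\<close> \<open>sets P = sets borel\<close> A1 A2 \<open>regression_function P fstar\<close> well_specified)
  define w where "w = sqrt (ln (4 * real CARD('p) / \<delta>) / real n)"
  \<comment> \<open>The bound on \<open>Y\<close> may be 0, whereas Bernstein's inequality is stated for a positive variance
    proxy. It is replaced by the largest bound compatible with \<open>lam\<close>, which is positive.\<close>
  define K where "K = 4 * w * (1 + B\<^sub>X / 2 * w)"
  define B where "B = lam / K"
  have "1 \<le> real CARD('p)" by (simp add: Suc_leI)
  then have "\<delta> < 4 * real CARD('p)" using \<open>\<delta> < 1\<close> by linarith
  then have "1 < 4 * real CARD('p) / \<delta>" using \<open>0 < \<delta>\<close> by (simp add: pos_less_divide_eq)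
  then have w: "0 < w" using \<open>1 \<le> n\<close> by (simp add: w_def)
  then have K: "0 < K" using given.B\<^sub>X_pos by (simp add: K_def add_pos_pos)
  have B: "0 < B" using K \<open>0 < lam\<close> by (simp add: B_def)
  have "B\<^sub>Y * K \<le> lam" using assms(16) unfolding w_def[symmetric] K_def by (simp add: mult_ac)
  then have "B\<^sub>Y \<le> B" using K by (simp add: B_def pos_le_divide_eq)
  then have bounded: "bounded_data P B B\<^sub>X"
    using A2 unfolding bounded_data_def by (auto elim!: eventually_mono)
  interpret semi_supervised_linear_model M P fstar \<beta>star B B\<^sub>X n N X Y
    by (intro semi_supervised_linear_model.intro semi_supervised_linear_model_axioms.intro
        bounded_linear_law.intro bounded_linear_law_axioms.intro \<open>prob_space M\<close> \<open>prob_space P\<close>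
        \<open>sets P = sets borel\<close> A1 bounded \<open>regression_function P fstar\<close> well_specified
        \<open>1 \<le> n\<close> \<open>n < N\<close> \<open>semi_supervised_sample M P n N X Y\<close>)
  have lam_ge: "4 * B * sqrt (ln (4 * real CARD('p) / \<delta>) / real n)
           * (1 + B\<^sub>X / 2 * sqrt (ln (4 * real CARD('p) / \<delta>) / real n)) \<le> lam"
  proof -
    have "4 * B * w * (1 + B\<^sub>X / 2 * w) = B * K" by (simp add: K_def)
    also have "\<dots> = lam" using K by (simp add: B_def)
    finally show ?thesis unfolding w_def[symmetric] by simp
  qed
  note main = semi_supervised_lasso_excess_risk[OF B \<open>0 < \<delta>\<close> \<open>\<delta> < 1\<close> \<open>0 < lam\<close> lam_ge
      \<open>\<beta>hat \<in> borel_measurable M\<close> assms(19) \<open>Jstar = {j. \<beta>star $ j \<noteq> 0}\<close>]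
  show ?thesis
    unfolding assms(17) \<open>sstar = card Jstar\<close> using main by blast
qed

end
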